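(* Let $s\in\{1,\dots,p\}$ and assume that the $SRE(s,5/3)$ condition holds, with associated constant $\kappa=\kappa(s)$. Choose the tuning parameter $$\lambda=\gamma\sqrt{\frac1n\log\left(\frac{2p}{s}\right)},$$ and assume that $$\gamma\ge16+4\sqrt2\qquad\text{and}\qquad\frac{s}{n}\log\left(\frac{2p}{s}\right)\le\frac{9\kappa^2}{256\gamma^2}.$$ Let $\hat\beta^{SQL}$ be the Square-Root Lasso estimator with tuning parameter $\lambda$. Then, for every $\delta_0\ge\exp(-n/(4\gamma^2))$ and every $\beta^*\in\mathbb{R}^p$ such that $|\beta^*|_0\le s$, with $\mathbb{P}_{\beta^*}$-probability at least $1-\delta_0-(1+e^2)e^{-n/24}$, we have $$\|\mathbb{X}(\hat\beta^{SQL}-\beta^* )\|_n\le\sigma\max\left(\frac{C_1}{\kappa^2}\sqrt{\frac sn\log\left(\frac{p}{s}\right)},\ C_2\sqrt{\frac{\log(1/\delta_0)}{n}}\right),$$ $$|\hat\beta^{SQL}-\beta^*|_q\le\sigma\max\left(\frac{C_3}{\kappa^2}s^{1/q}\sqrt{\frac1n\log\left(\frac{2p}{s}\right)},\ C_4 s^{1/q-1}\sqrt{\frac{\log^2(1/\delta_0)}{n\log(2p/s)}}\right),$$ where $1\le q\le2$, and $C_1>0$, $C_2>0$, $C_3>0$, $C_4>0$ are constants depending only on $\gamma$.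
   Context: Model: $Y=\mathbb{X}\beta^*+\varepsilon\in\mathbb{R}^n$, where $\mathbb{X}\in\mathbb{R}^{n\times p}$ is the design matrix, $\beta^*\in\mathbb{R}^p$ is the unknown true parameter and $\varepsilon\sim\mathcal N(0,\sigma^2I_{n\times n})$; $\mathbb{P}_{\beta^*}$ is the distribution of $Y$. Notation: $|\cdot|_q$ is the $\ell_q$ norm, $|\cdot|_0$ the number of non-zero coordinates, $\|u\|_n^2=\frac1n\sum_{i=1}^nu_i^2$ for $u\in\mathbb{R}^n$, and $(e_j)_{j=1}^p$ is the canonical basis of $\mathbb{R}^p$. Square-Root Lasso with tuning parameter $\lambda>0$: any $$\hat\beta^{SQL}\in\arg\min_{\beta\in\mathbb{R}^p}\left(\frac1{\sqrt n}|Y-\mathbb{X}\beta|_2+\lambda|\beta|_1\right).$$ $SRE(s,c_0)$ condition ($c_0>0$): $\max_{j=1,\dots,p}\|\mathbb{X}e_j\|_n\le1$ and $$\kappa(s):=\min_{\delta\in C_{SRE}(s,c_0),\ \delta\ne0}\frac{\|\mathbb{X}\delta\|_n}{|\delta|_2}>0,\qquad C_{SRE}(s,c_0):=\{\delta\in\mathbb{R}^p:|\delta|_1\le(1+c_0)\sqrt s\,|\delta|_2\}.$$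
   Formalization: The prediction bound is proved with log(2p/s) in place of log(p/s) for all s in {1,…,p}, and as printed with log(p/s) only when 2s ≤ p; as printed it fails at s = p, where log(p/s) = 0 (orthogonal design, large coefficients, large p). *)

theory Defs
  imports "HOL-Probability.Probability"
begin

(* The constants of the theorem must not depend on the dimensions n and p, so both are quantified
   inside the formula and cannot be types. A vector of R^d is therefore a function on nat of which
   only the coordinates below d are ever read; an n x p matrix X has entries X i j, i < n, j < p. *)

definition mat_vec :: "nat \<Rightarrow> (nat \<Rightarrow> nat \<Rightarrow> real) \<Rightarrow> (nat \<Rightarrow> real) \<Rightarrow> (nat \<Rightarrow> real)" where
  "mat_vec p X b = (\<lambda>i. \<Sum>j<p. X i j * b j)"

definition lq_norm :: "nat \<Rightarrow> real \<Rightarrow> (nat \<Rightarrow> real) \<Rightarrow> real" where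
  "lq_norm d q u = (\<Sum>j<d. \<bar>u j\<bar> powr q) powr (1 / q)"

definition l0_norm :: "nat \<Rightarrow> (nat \<Rightarrow> real) \<Rightarrow> nat" where
  "l0_norm d u = card {j. j < d \<and> u j \<noteq> 0}"

definition emp_norm :: "nat \<Rightarrow> (nat \<Rightarrow> real) \<Rightarrow> real" where
  "emp_norm n u = sqrt ((1 / real n) * (\<Sum>i<n. (u i)\<^sup>2))"

definition basis_vec :: "nat \<Rightarrow> (nat \<Rightarrow> real)" where
  "basis_vec j = (\<lambda>k. if k = j then 1 else 0)"

definition gaussian_noise :: "nat \<Rightarrow> real \<Rightarrow> (nat \<Rightarrow> real) measure" where
  "gaussian_noise n \<sigma> = (\<Pi>\<^sub>M i\<in>{..<n}. distr std_normal_distribution borel (\<lambda>z. \<sigma> * z))"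

(* The law of Y = X beta + eps on R^n, realised as the product space of functions on {..<n}. *)
definition regression_law ::
    "nat \<Rightarrow> nat \<Rightarrow> (nat \<Rightarrow> nat \<Rightarrow> real) \<Rightarrow> (nat \<Rightarrow> real) \<Rightarrow> real \<Rightarrow> (nat \<Rightarrow> real) measure" where
  "regression_law n p X \<beta> \<sigma> =
     distr (gaussian_noise n \<sigma>) (\<Pi>\<^sub>M i\<in>{..<n}. borel) (\<lambda>\<epsilon>. \<lambda>i\<in>{..<n}. mat_vec p X \<beta> i + \<epsilon> i)"

definition sqrt_lasso ::
    "nat \<Rightarrow> nat \<Rightarrow> (nat \<Rightarrow> nat \<Rightarrow> real) \<Rightarrow> real \<Rightarrow> (nat \<Rightarrow> real) \<Rightarrow> (nat \<Rightarrow> real) set" where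
  "sqrt_lasso n p X lam y =
     {b. is_arg_min
           (\<lambda>\<beta>. (1 / sqrt (real n)) * lq_norm n 2 (\<lambda>i. y i - mat_vec p X \<beta> i) + lam * lq_norm p 1 \<beta>)
           (\<lambda>_. True) b}"

definition sre_cone :: "nat \<Rightarrow> nat \<Rightarrow> real \<Rightarrow> (nat \<Rightarrow> real) set" where
  "sre_cone p s c0 = {\<delta>. lq_norm p 1 \<delta> \<le> (1 + c0) * sqrt (real s) * lq_norm p 2 \<delta>}"

(* For 1 <= s <= p this infimum is attained: the set is nonempty (it contains the ratios of the
   basis vectors) and, by homogeneity, is the image of a compact part of the unit sphere. *)
definition sre_kappa :: "nat \<Rightarrow> nat \<Rightarrow> (nat \<Rightarrow> nat \<Rightarrow> real) \<Rightarrow> nat \<Rightarrow> real \<Rightarrow> real" where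
  "sre_kappa n p X s c0 =
     Inf {emp_norm n (mat_vec p X \<delta>) / lq_norm p 2 \<delta> | \<delta>.
            \<delta> \<in> sre_cone p s c0 \<and> (\<exists>j<p. \<delta> j \<noteq> 0)}"

definition SRE :: "nat \<Rightarrow> nat \<Rightarrow> (nat \<Rightarrow> nat \<Rightarrow> real) \<Rightarrow> nat \<Rightarrow> real \<Rightarrow> bool" where
  "SRE n p X s c0 \<longleftrightarrow>
     (\<forall>j<p. emp_norm n (mat_vec p X (basis_vec j)) \<le> 1) \<and> sre_kappa n p X s c0 > 0"

(* "The event E has probability at least r". The event of the theorem need not be measurable when
   the selected minimiser is not a measurable function of the data; the inner form used here
   coincides with  measure M E >= r  whenever E is measurable. *)
definition prob_at_least :: "'a measure \<Rightarrow> 'a set \<Rightarrow> real \<Rightarrow> bool" where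
  "prob_at_least M E r \<longleftrightarrow> (\<exists>A\<in>sets M. A \<subseteq> E \<and> measure M A \<ge> r)"

end

theory Submission
  imports Defs
begin

text \<open>
  Write \<open>u = \<beta>hat - \<beta>\<close> for the estimation error, \<open>Lam = sqrt (ln (2 p / s))\<close>, and let \<open>\<xi>\<close> be a
  standard Gaussian vector of \<open>\<real>^n\<close>, so that the noise is \<open>\<sigma> \<xi>\<close>. The theorem combines a uniform
  bound on the noise, which is the only probabilistic ingredient besides two chi-square tails, with
  a deterministic argument.

  The noise has to be controlled at the random vector \<open>X u\<close>, in the form
  \<open>\<langle>\<xi>, X u\<rangle> \<le> |X u| (c sqrt (ln (1 / \<delta>0)) + c' Lam sqrt s) + c'' Lam sqrt n |u|_1\<close>
  for all \<open>u\<close> simultaneously. Concentration of a supremum is avoided by Maurey's empirical method.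
  The vector \<open>X u / |u|_1\<close> is a convex combination of signed columns; sampling \<open>k\<close> columns at random
  gives an average with the right mean and with expected squared norm at most \<open>|X u|^2 / |u|_1^2 + n / k\<close>.
  The Gaussian functional being linear, some sampled vector does at least as well as the mean
  (\<open>maurey_counts\<close>), so a bound at the countably many integer combinations of columns
  transfers to every \<open>u\<close> (\<open>noise_bound_from_counts\<close>), and the best \<open>k \<ge> s\<close> yields the
  displayed inequality (\<open>choose_sample_size\<close>). Integer combinations with \<open>k\<close> terms are few enough
  for a union bound at level \<open>\<delta>0 exp (- 5 k Lam^2)\<close>; since only \<open>k \<ge> s\<close> occur, the price per term is
  \<open>ln (2 p / s)\<close> rather than \<open>ln p\<close> (\<open>count_vs_tail\<close>, \<open>uniform_count_event\<close>).

  For the deterministic part, the chi-square tails place \<open>N = |\<epsilon>|_n\<close> between \<open>\<sigma> / sqrt 2\<close> and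
  \<open>sqrt 2 \<sigma>\<close>. Optimality of the estimator and convexity of the residual norm give
  \<open>lam |u_C|_1 \<le> lam |u_S|_1 + \<tau> |X u|_n + \<eta> lam |u|_1\<close> on the support \<open>S\<close> of \<open>\<beta>\<close> and its
  complement \<open>C\<close>, where \<open>\<tau>\<close> is of order \<open>sqrt (ln (1 / \<delta>0) / n) + Lam sqrt (s / n)\<close> and
  \<open>\<eta> < 1/4\<close> thanks to the lower bound on \<open>\<gamma>\<close>. Either \<open>\<tau> |X u|_n\<close> is small compared with
  \<open>lam sqrt s |u|_2\<close>, and then \<open>u\<close> lies in the restricted eigenvalue cone and \<open>\<kappa>\<close> converts
  \<open>|u|_2\<close> into \<open>|X u|_n\<close>; or it is not, and then \<open>|u|_1\<close> and \<open>|u|_2\<close> are directly bounded by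
  \<open>\<tau> |X u|_n\<close>. Expanding the square of the residual norm bounds \<open>|X u|_n\<close> in both cases
  (\<open>basic_inequality_dichotomy\<close>, \<open>sqrt_lasso_deterministic\<close>). The terms
  with \<open>ln (1 / \<delta>0)\<close> come from the second case only. The norms \<open>|u|_q\<close> follow by interpolation between \<open>q = 1\<close> and \<open>q = 2\<close>.
\<close>

section \<open>Norms and the restricted eigenvalue constant\<close>

lemma lq_norm_1: "lq_norm d 1 u = (\<Sum>j<d. \<bar>u j\<bar>)"
  by (simp add: lq_norm_def sum_nonneg)

lemma lq_norm_2: "lq_norm d 2 u = sqrt (\<Sum>j<d. (u j)\<^sup>2)"
  by (simp add: lq_norm_def sum_nonneg powr_half_sqrt)

text \<open>
  A vector with \<open>S\<close> entries equal to \<open>R\<close> attains both hypotheses, and the conclusion is twice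
  its norm. Estimating \<open>x powr q\<close> by \<open>x + x\<^sup>2\<close> costs this factor and replaces
  Hoelder's inequality.
\<close>

lemma lq_norm_interpolation:
  assumes q: "1 \<le> q" "q \<le> 2" and R: "0 \<le> R" and S: "0 \<le> S"
    and l1: "(\<Sum>j<d. \<bar>u j\<bar>) \<le> S * R" and l2: "(\<Sum>j<d. (u j)\<^sup>2) \<le> S * R\<^sup>2"
  shows "lq_norm d q u \<le> 2 * S powr (1 / q) * R"
proof (cases "R = 0")
  case True
  then have "(\<Sum>j<d. \<bar>u j\<bar>) = 0" using l1 by (simp add: order_antisym sum_nonneg)
  then have "u j = 0" if "j < d" for j using that by (simp add: sum_nonneg_eq_0_iff)
  then show ?thesis using True by (simp add: lq_norm_def)
next
  case False
  then have R: "0 < R" using R by simp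
  \<comment> \<open>\<open>x powr q \<le> max x (x\<^sup>2)\<close> for \<open>x \<ge> 0\<close>, after rescaling by \<open>R\<close>.\<close>
  have pt: "\<bar>v\<bar> powr q \<le> R powr q * (\<bar>v\<bar> / R + (v / R)\<^sup>2)" for v
  proof -
    define x where "x = \<bar>v\<bar> / R"
    have x: "0 \<le> x" using R by (simp add: x_def)
    have "x powr q \<le> x + x\<^sup>2"
    proof (cases "x \<le> 1")
      case True
      then have "x powr q \<le> x powr 1" by (intro powr_mono') (use x q in simp_all)
      then show ?thesis using x by (simp add: add_increasing2)
    next
      case False
      then have "x powr q \<le> x powr 2" using x q by (intro powr_mono) auto
      then show ?thesis using x False by simp
    qed
    then have "R powr q * x powr q \<le> R powr q * (x + x\<^sup>2)" by (intro mult_left_mono) auto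
    moreover have "R powr q * x powr q = \<bar>v\<bar> powr q"
      using R x by (simp add: powr_mult[symmetric] x_def)
    moreover have "x\<^sup>2 = (v / R)\<^sup>2" by (simp add: x_def power_divide)
    ultimately show ?thesis by (simp add: x_def)
  qed
  have "(\<Sum>j<d. \<bar>u j\<bar> powr q) \<le> (\<Sum>j<d. R powr q * (\<bar>u j\<bar> / R + (u j / R)\<^sup>2))"
    by (intro sum_mono pt)
  also have "\<dots> = R powr q * ((\<Sum>j<d. \<bar>u j\<bar>) / R + (\<Sum>j<d. (u j)\<^sup>2) / R\<^sup>2)"
    by (simp add: sum_distrib_left[symmetric] sum.distrib sum_divide_distrib power_divide)
  also have "\<dots> \<le> R powr q * (S + S)"
    using l1 l2 R by (intro mult_left_mono add_mono) (auto simp: field_simps)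
  finally have "(\<Sum>j<d. \<bar>u j\<bar> powr q) \<le> R powr q * (2 * S)" by simp
  then have "lq_norm d q u \<le> (R powr q * (2 * S)) powr (1 / q)"
    unfolding lq_norm_def using q by (intro powr_mono2) (auto intro: sum_nonneg)
  also have "\<dots> = R * (2 powr (1/q) * S powr (1/q))"
    using R S q by (simp add: powr_mult powr_powr)
  also have "\<dots> \<le> R * (2 * S powr (1/q))"
  proof -
    have "(2::real) powr (1/q) \<le> 2 powr 1" using q by (intro powr_mono) auto
    then show ?thesis using R by (intro mult_left_mono mult_right_mono) auto
  qed
  finally show ?thesis by (simp add: mult.commute mult.left_commute)
qed

lemma emp_norm_eq: "emp_norm n v = sqrt (\<Sum>i<n. (v i)\<^sup>2) / sqrt (real n)"
  by (simp add: emp_norm_def real_sqrt_divide)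

lemma sum_abs_le_sqrt_card:
  fixes p s :: nat
  assumes "finite S" "S \<subseteq> {..<p}" "card S \<le> s"
  shows "(\<Sum>j\<in>S. \<bar>u j\<bar>) \<le> sqrt (real s) * sqrt (\<Sum>j<p. (u j)\<^sup>2 :: real)"
proof -
  have "(\<Sum>j\<in>S. \<bar>u j\<bar>)\<^sup>2 \<le> (\<Sum>j\<in>S. 1\<^sup>2) * (\<Sum>j\<in>S. \<bar>u j\<bar>\<^sup>2)"
    using Cauchy_Schwarz_ineq_sum[of "\<lambda>_. 1" "\<lambda>j. \<bar>u j\<bar>" S] by simp
  also have "\<dots> \<le> real s * (\<Sum>j<p. (u j)\<^sup>2)"
    using assms by (intro mult_mono) (auto intro!: sum_mono2 sum_nonneg)
  finally have "(\<Sum>j\<in>S. \<bar>u j\<bar>) \<le> sqrt (real s * (\<Sum>j<p. (u j)\<^sup>2))" by (rule real_le_rsqrt)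
  then show ?thesis by (simp add: real_sqrt_mult)
qed

lemma sre_kappa_mult_le:
  assumes cone: "u \<in> sre_cone p s c0" and \<kappa>: "\<kappa> = sre_kappa n p X s c0"
  shows "\<kappa> * lq_norm p 2 u \<le> emp_norm n (mat_vec p X u)"
proof (cases "\<exists>j<p. u j \<noteq> 0")
  case False
  then show ?thesis by (simp add: lq_norm_2 emp_norm_eq sum_nonneg)
next
  case True
  let ?S = "{emp_norm n (mat_vec p X \<delta>) / lq_norm p 2 \<delta> | \<delta>.
            \<delta> \<in> sre_cone p s c0 \<and> (\<exists>j<p. \<delta> j \<noteq> 0)}"
  have "0 \<le> emp_norm n (mat_vec p X \<delta>) / lq_norm p 2 \<delta>" for \<delta>
    by (simp add: lq_norm_2 emp_norm_eq sum_nonneg)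
  then have "bdd_below ?S" by (intro bdd_belowI[of _ 0]) auto
  moreover have "emp_norm n (mat_vec p X u) / lq_norm p 2 u \<in> ?S" using cone True by blast
  ultimately have "\<kappa> \<le> emp_norm n (mat_vec p X u) / lq_norm p 2 u"
    unfolding \<kappa> sre_kappa_def by (intro cInf_lower)
  moreover have "0 < lq_norm p 2 u"
  proof -
    have "(\<Sum>j<p. (u j)\<^sup>2) \<noteq> 0" using True by (auto simp: sum_nonneg_eq_0_iff)
    then show ?thesis by (simp add: lq_norm_2 less_le sum_nonneg)
  qed
  ultimately show ?thesis by (simp add: field_simps)
qed

lemma mat_vec_basis_vec: "j < p \<Longrightarrow> mat_vec p X (basis_vec j) i = X i j"
  by (simp add: mat_vec_def basis_vec_def if_distrib cong: if_cong)

text \<open>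
  The first basis vector lies in the cone and is mapped to a column of norm at most one. This is
  what allows terms without \<open>\<kappa>\<close> to be absorbed into terms with a factor \<open>1 / \<kappa>\<^sup>2\<close>.
\<close>

lemma sre_kappa_le_1:
  assumes sre: "SRE n p X s c0" and c0: "0 \<le> c0" and s: "1 \<le> s" and p: "1 \<le> p"
  shows "sre_kappa n p X s c0 \<le> 1"
proof -
  have n1: "lq_norm p 1 (basis_vec 0) = 1" "lq_norm p 2 (basis_vec 0) = 1"
    unfolding lq_norm_1 lq_norm_2 using p
    by (simp_all add: basis_vec_def if_distrib[of abs] if_distrib[of "\<lambda>x. x\<^sup>2"] cong: if_cong)
  have "1 * 1 \<le> (1 + c0) * sqrt (real s)" using c0 s by (intro mult_mono) auto
  then have "basis_vec 0 \<in> sre_cone p s c0" by (simp add: sre_cone_def n1)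
  from sre_kappa_mult_le[OF this refl, of n X]
  have "sre_kappa n p X s c0 \<le> emp_norm n (mat_vec p X (basis_vec 0))" by (simp add: n1)
  also have "\<dots> \<le> 1" using sre p by (simp add: SRE_def)
  finally show ?thesis .
qed

section \<open>Sparse integer combinations by random sampling\<close>

text \<open>
  A concave quadratic surrogate for comparing \<open>\<langle>e, x\<rangle>\<close> with a multiple of \<open>|x|\<close>: unlike the norm
  itself, its expectation under random sampling can be computed exactly.
\<close>

definition penalised :: "nat \<Rightarrow> (nat \<Rightarrow> real) \<Rightarrow> real \<Rightarrow> (nat \<Rightarrow> real) \<Rightarrow> real" where
  "penalised n e b x = (\<Sum>r<n. e r * x r - b * (x r)\<^sup>2)"

text \<open>
  If \<open>i\<close> is drawn with probabilities \<open>w\<close>, the perturbation \<open>z i - E z\<close> is centred, so the linear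
  part of the functional does not change in expectation and the quadratic part loses at most \<open>b\<close>
  times the variance. Some index does at least as well as the average.
\<close>

lemma average_step:
  fixes z :: "'i \<Rightarrow> nat \<Rightarrow> real" and w :: "'i \<Rightarrow> real"
  assumes fin: "finite I" and w0: "\<And>i. i \<in> I \<Longrightarrow> 0 \<le> w i" and w1: "sum w I = 1"
    and D: "\<And>i. i \<in> I \<Longrightarrow> (\<Sum>r<n. (z i r)\<^sup>2) \<le> D" and b: "0 \<le> b"
  shows "\<exists>i\<in>I. penalised n e b x - b * D
           \<le> penalised n e b (\<lambda>r. x r + z i r - (\<Sum>j\<in>I. w j * z j r))"
proof (rule ccontr)
  define m where "m r = (\<Sum>j\<in>I. w j * z j r)" for r
  define F where "F i = penalised n e b (\<lambda>r. x r + z i r - m r)" for i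
  assume "\<not> ?thesis"
  then have less: "F i < penalised n e b x - b * D" if "i \<in> I" for i
    using that by (auto simp: F_def m_def not_le)
  obtain i0 where i0: "i0 \<in> I" "0 < w i0"
  proof (rule ccontr)
    assume "\<not> thesis"
    then have "w i = 0" if "i \<in> I" for i using that w0[OF that] \<open>\<And>i. i \<in> I \<Longrightarrow> 0 < w i \<Longrightarrow> thesis\<close>
      by force
    then show False using w1 by simp
  qed
  have "(\<Sum>i\<in>I. w i * F i) < (\<Sum>i\<in>I. w i * (penalised n e b x - b * D))"
  proof (rule sum_strict_mono_ex1[OF fin])
    show "\<forall>i\<in>I. w i * F i \<le> w i * (penalised n e b x - b * D)"
      by (intro ballI mult_left_mono less_imp_le[OF less] w0)
    show "\<exists>i\<in>I. w i * F i < w i * (penalised n e b x - b * D)"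
      using i0 less[of i0] by (intro bexI[of _ i0] mult_strict_left_mono)
  qed
  also have "\<dots> = penalised n e b x - b * D"
    by (simp add: sum_distrib_right[symmetric] w1)
  finally have lt: "(\<Sum>i\<in>I. w i * F i) < penalised n e b x - b * D" .
  \<comment> \<open>Coordinatewise, averaging the penalised value over the random step costs the variance
    \<open>E z\<^sup>2 - (E z)\<^sup>2\<close> of the step, weighted by \<open>b\<close>.\<close>
  have row: "(\<Sum>i\<in>I. w i * (e r * (x r + z i r - m r) - b * (x r + z i r - m r)\<^sup>2))
      = e r * x r - b * (x r)\<^sup>2 - b * ((\<Sum>i\<in>I. w i * (z i r)\<^sup>2) - (m r)\<^sup>2)" for r
  proof -
    have "(\<Sum>i\<in>I. w i * (e r * (x r + z i r - m r) - b * (x r + z i r - m r)\<^sup>2))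
       = (\<Sum>i\<in>I. w i * (e r * (x r - m r) - b * (x r - m r)\<^sup>2)
              + (w i * z i r) * (e r - 2 * b * (x r - m r)) - b * (w i * (z i r)\<^sup>2))"
      by (rule sum.cong) (auto simp: power2_eq_square algebra_simps)
    also have "\<dots> = (e r * (x r - m r) - b * (x r - m r)\<^sup>2)
              + m r * (e r - 2 * b * (x r - m r)) - b * (\<Sum>i\<in>I. w i * (z i r)\<^sup>2)"
      by (simp add: sum.distrib sum_subtractf sum_distrib_right[symmetric] sum_distrib_left[symmetric] w1 m_def)
    also have "\<dots> = e r * x r - b * (x r)\<^sup>2 - b * ((\<Sum>i\<in>I. w i * (z i r)\<^sup>2) - (m r)\<^sup>2)"
      by (simp add: power2_eq_square algebra_simps)
    finally show ?thesis .
  qed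
  have "(\<Sum>i\<in>I. w i * F i)
      = (\<Sum>r<n. \<Sum>i\<in>I. w i * (e r * (x r + z i r - m r) - b * (x r + z i r - m r)\<^sup>2))"
    unfolding F_def penalised_def sum_distrib_left by (rule sum.swap)
  also have "\<dots> = penalised n e b x - b * ((\<Sum>r<n. \<Sum>i\<in>I. w i * (z i r)\<^sup>2) - (\<Sum>r<n. (m r)\<^sup>2))"
    unfolding row penalised_def by (simp add: sum_subtractf sum_distrib_left[symmetric] sum.distrib)
  also have "(\<Sum>r<n. \<Sum>i\<in>I. w i * (z i r)\<^sup>2) = (\<Sum>i\<in>I. w i * (\<Sum>r<n. (z i r)\<^sup>2))"
    unfolding sum_distrib_left by (rule sum.swap)
  finally have eq: "(\<Sum>i\<in>I. w i * F i)
      = penalised n e b x - b * ((\<Sum>i\<in>I. w i * (\<Sum>r<n. (z i r)\<^sup>2)) - (\<Sum>r<n. (m r)\<^sup>2))" .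
  have "(\<Sum>i\<in>I. w i * (\<Sum>r<n. (z i r)\<^sup>2)) \<le> (\<Sum>i\<in>I. w i * D)"
    using w0 D by (intro sum_mono mult_left_mono) auto
  also have "\<dots> = D" by (simp add: sum_distrib_right[symmetric] w1)
  finally have "(\<Sum>i\<in>I. w i * (\<Sum>r<n. (z i r)\<^sup>2)) - (\<Sum>r<n. (m r)\<^sup>2) \<le> D"
    using sum_nonneg[of "{..<n}" "\<lambda>r. (m r)\<^sup>2"] by simp
  then have "b * ((\<Sum>i\<in>I. w i * (\<Sum>r<n. (z i r)\<^sup>2)) - (\<Sum>r<n. (m r)\<^sup>2)) \<le> b * D"
    using b by (rule mult_left_mono)
  then show False using lt eq by simp
qed

text \<open>
  Maurey's sampling argument, derandomised: \<open>k\<close> independent draws from \<open>w\<close> are replaced one by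
  one by good indices, and only the number of times that each index is chosen is recorded.
\<close>

lemma maurey_counts:
  fixes z :: "'i \<Rightarrow> nat \<Rightarrow> real" and w :: "'i \<Rightarrow> real"
  assumes fin: "finite I" and w0: "\<And>i. i \<in> I \<Longrightarrow> 0 \<le> w i" and w1: "sum w I = 1"
    and D: "\<And>i. i \<in> I \<Longrightarrow> (\<Sum>r<n. (z i r)\<^sup>2) \<le> D" and b: "0 \<le> b"
  shows "\<exists>c::'i \<Rightarrow> nat. sum c I = k \<and>
     penalised n e b (\<lambda>r. x r + real k * (\<Sum>i\<in>I. w i * z i r)) - b * (real k * D)
       \<le> penalised n e b (\<lambda>r. x r + (\<Sum>i\<in>I. real (c i) * z i r))"
proof (induction k arbitrary: x)
  case 0
  show ?case by (rule exI[of _ "\<lambda>_. 0"]) simp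
next
  case (Suc k)
  define m where "m r = (\<Sum>i\<in>I. w i * z i r)" for r
  \<comment> \<open>One sampled summand replaces one copy of the mean; the shift \<open>x\<close> absorbs it.\<close>
  have "\<exists>i\<in>I. penalised n e b (\<lambda>r. x r + real (Suc k) * m r) - b * D
        \<le> penalised n e b (\<lambda>r. x r + real (Suc k) * m r + z i r - m r)"
    unfolding m_def by (rule average_step[OF fin w0 w1 D b])
  then obtain i where i: "i \<in> I"
    and step: "penalised n e b (\<lambda>r. x r + real (Suc k) * m r) - b * D
        \<le> penalised n e b (\<lambda>r. x r + real (Suc k) * m r + z i r - m r)"
    by (elim bexE)
  have "\<exists>c. sum c I = k \<and> penalised n e b (\<lambda>r. (x r + z i r) + real k * m r) - b * (real k * D)
       \<le> penalised n e b (\<lambda>r. (x r + z i r) + (\<Sum>i\<in>I. real (c i) * z i r))"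
    unfolding m_def by (rule Suc)
  then obtain c where c: "sum c I = k"
    and IH: "penalised n e b (\<lambda>r. (x r + z i r) + real k * m r) - b * (real k * D)
       \<le> penalised n e b (\<lambda>r. (x r + z i r) + (\<Sum>i\<in>I. real (c i) * z i r))"
    by (elim exE conjE)
  define c' where "c' = c(i := Suc (c i))"
  have "sum c' I = Suc k"
    using fin i c by (simp add: c'_def sum.remove)
  moreover have "(\<Sum>j\<in>I. real (c' j) * z j r) = z i r + (\<Sum>j\<in>I. real (c j) * z j r)" for r
    using fin i by (simp add: c'_def sum.remove algebra_simps)
  ultimately show ?case
    using IH step unfolding m_def[symmetric]
    by (intro exI[of _ c']) (simp add: algebra_simps)
qed

text \<open>
  An integer combination of the columns, encoded by a list of \<open>2 p\<close> natural numbers: the positive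
  parts of the coefficients followed by the negative parts. In this form the combinations with
  \<open>k\<close> terms are counted by \<open>card_length_sum_list\<close>.
\<close>

definition column_comb :: "nat \<Rightarrow> (nat \<Rightarrow> nat \<Rightarrow> real) \<Rightarrow> nat list \<Rightarrow> nat \<Rightarrow> real" where
  "column_comb p X l r = (\<Sum>j<p. X r j * (real (l ! j) - real (l ! (p + j))))"

text \<open>
  A bound \<open>\<langle>e, v\<rangle> \<le> a |v|\<close> at all integer combinations \<open>v\<close> with exactly \<open>k\<close> terms extends to all
  vectors \<open>X u\<close>, with \<open>|X u|\<close> enlarged, in quadrature, by the standard deviation \<open>sqrt (n / k) |u|_1\<close> of the
  sampling scheme.
\<close>

lemma noise_bound_from_counts:
  fixes a :: real
  assumes n: "1 \<le> n" and k: "1 \<le> k" and a: "0 \<le> a"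
    and col: "\<And>j. j < p \<Longrightarrow> (\<Sum>r<n. (X r j)\<^sup>2) \<le> real n"
    and ev: "\<And>l. length l = 2 * p \<Longrightarrow> sum_list l = k \<Longrightarrow>
        (\<Sum>r<n. e r * column_comb p X l r) \<le> a * sqrt (\<Sum>r<n. (column_comb p X l r)\<^sup>2)"
  shows "(\<Sum>r<n. e r * mat_vec p X u r)
     \<le> a * sqrt ((\<Sum>r<n. (mat_vec p X u r)\<^sup>2) + real n * (\<Sum>j<p. \<bar>u j\<bar>)\<^sup>2 / real k)"
proof -
  define U where "U = (\<Sum>j<p. \<bar>u j\<bar>)"
  have U0: "0 \<le> U" by (simp add: U_def sum_nonneg)
  show ?thesis
  proof (cases "U = 0")
    case True
    then have "u j = 0" if "j < p" for j using that by (simp add: U_def sum_nonneg_eq_0_iff)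
    then show ?thesis by (simp add: mat_vec_def)
  next
    case False
    then have U: "0 < U" using U0 by simp
    \<comment> \<open>Choosing the sign of each column according to \<open>u\<close> makes \<open>X u / U\<close> a convex combination.
      The value of the sign at \<open>u j = 0\<close> must be nonzero and agree with the branch taken in the
      list \<open>l\<close> below, since nothing forces the count \<open>c j\<close> to vanish there.\<close>
    define sg where "sg j = (if 0 \<le> u j then 1 else -1 :: real)" for j
    define z where "z j r = sg j * X r j" for j r
    define m where "m r = mat_vec p X u r / U" for r
    have wz: "(\<Sum>j<p. \<bar>u j\<bar> / U * z j r) = m r" for r
    proof -
      have "\<bar>u j\<bar> / U * z j r = X r j * u j / U" for j
        by (simp add: z_def sg_def)
      then show ?thesis unfolding m_def mat_vec_def sum_divide_distrib by (intro sum.cong) simp_all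
    qed
    define T where "T = real k ^ 2 * (\<Sum>r<n. (m r)\<^sup>2) + real k * real n"
    have T: "0 < T" unfolding T_def using n k by (intro add_nonneg_pos mult_nonneg_nonneg sum_nonneg) auto
    define q where "q = real k * (\<Sum>r<n. e r * m r)"
    \<comment> \<open>For every penalty weight the sampled combination is nearly as good as the mean, while the
      hypothesis caps it by \<open>a Q - b Q\<^sup>2\<close>, whose maximum over \<open>Q\<close> is \<open>a\<^sup>2 / (4 b)\<close>.\<close>
    have key: "q - b * T \<le> a\<^sup>2 / (4 * b)" if b: "0 < b" for b
    proof -
      have "\<exists>c. sum c {..<p} = k \<and>
         penalised n e b (\<lambda>r. 0 + real k * (\<Sum>j<p. \<bar>u j\<bar> / U * z j r)) - b * (real k * real n)
           \<le> penalised n e b (\<lambda>r. 0 + (\<Sum>j<p. real (c j) * z j r))"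
      proof (rule maurey_counts)
        show "(\<Sum>j<p. \<bar>u j\<bar> / U) = 1"
          using U by (simp add: sum_divide_distrib[symmetric] U_def[symmetric])
        show "(\<Sum>r<n. (z j r)\<^sup>2) \<le> real n" if "j \<in> {..<p}" for j
          using col[of j] that by (simp add: z_def sg_def power_mult_distrib)
      qed (use U b in auto)
      then obtain c where c: "sum c {..<p} = k" and
        cle: "penalised n e b (\<lambda>r. real k * m r) - b * (real k * real n)
           \<le> penalised n e b (\<lambda>r. \<Sum>j<p. real (c j) * z j r)"
        unfolding wz by auto
      define l where "l = map (\<lambda>j. if 0 \<le> u j then c j else 0) [0..<p]
                        @ map (\<lambda>j. if 0 \<le> u j then 0 else c j) [0..<p]"
      have len: "length l = 2 * p" by (simp add: l_def)
      have "sum_list l = (\<Sum>j<p. (if 0 \<le> u j then c j else 0) + (if 0 \<le> u j then 0 else c j))"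
        by (simp add: l_def sum.distrib interv_sum_list_conv_sum_set_nat atLeast0LessThan)
      also have "\<dots> = k" unfolding c[symmetric] by (rule sum.cong) auto
      finally have suml: "sum_list l = k" .
      have comb: "(\<Sum>j<p. real (c j) * z j r) = column_comb p X l r" for r
        unfolding column_comb_def
        by (rule sum.cong) (auto simp: l_def nth_append z_def sg_def)
      define Q where "Q = sqrt (\<Sum>r<n. (column_comb p X l r)\<^sup>2)"
      have Q2: "Q\<^sup>2 = (\<Sum>r<n. (column_comb p X l r)\<^sup>2)" by (simp add: Q_def sum_nonneg)
      have "penalised n e b (\<lambda>r. \<Sum>j<p. real (c j) * z j r) \<le> a * Q - b * Q\<^sup>2"
        using ev[OF len suml] unfolding comb Q2 penalised_def Q_def[symmetric]
        by (simp add: sum_subtractf sum_distrib_left)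
      also have "\<dots> \<le> a\<^sup>2 / (4 * b)"
      proof -
        have "a\<^sup>2 / (4 * b) - (a * Q - b * Q\<^sup>2) = (a - 2 * b * Q)\<^sup>2 / (4 * b)"
          using b by (simp add: power2_eq_square field_simps)
        also have "\<dots> \<ge> 0" using b by simp
        finally show ?thesis by simp
      qed
      finally have up: "penalised n e b (\<lambda>r. \<Sum>j<p. real (c j) * z j r) \<le> a\<^sup>2 / (4 * b)" .
      have "penalised n e b (\<lambda>r. real k * m r) - b * (real k * real n) = q - b * T"
        by (simp add: penalised_def q_def T_def sum_subtractf sum_distrib_left power_mult_distrib algebra_simps)
      then show ?thesis using cle up by simp
    qed
    have "q \<le> a * sqrt T"
    proof (cases "a = 0")
      case True
      show ?thesis
      proof (rule ccontr)
        assume "\<not> ?thesis"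
        then have "0 < q" using True by simp
        then show False using key[of "q / (2 * T)"] T True by simp
      qed
    next
      case False
      then have ap: "0 < a" using a by simp
      \<comment> \<open>\<open>b = a / (2 sqrt T)\<close> is the minimiser of \<open>b T + a\<^sup>2 / (4 b)\<close>.\<close>
      have sT: "sqrt T * sqrt T = T" "0 < sqrt T" using T by simp_all
      have "q - a / (2 * sqrt T) * T \<le> a\<^sup>2 / (4 * (a / (2 * sqrt T)))"
        by (rule key) (use ap T in simp)
      also have "a\<^sup>2 / (4 * (a / (2 * sqrt T))) = a * sqrt T / 2"
        using ap T by (simp add: power2_eq_square)
      also have "a / (2 * sqrt T) * T = a * sqrt T / 2"
        using sT by (simp add: field_simps)
      finally show ?thesis by simp
    qed
    then have "U / real k * q \<le> U / real k * (a * sqrt T)"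
      using U k by (intro mult_left_mono) auto
    moreover have "U / real k * q = (\<Sum>r<n. e r * mat_vec p X u r)"
      using U k by (simp add: q_def m_def sum_distrib_left field_simps)
    moreover have "U / real k * sqrt T
       = sqrt ((\<Sum>r<n. (mat_vec p X u r)\<^sup>2) + real n * U\<^sup>2 / real k)"
    proof -
      have "U / real k * sqrt T = sqrt ((U / real k)\<^sup>2 * T)"
        using U k by (simp add: real_sqrt_mult)
      also have "(\<Sum>r<n. (m r)\<^sup>2) = (\<Sum>r<n. (mat_vec p X u r)\<^sup>2) / U\<^sup>2"
        by (simp add: m_def power_divide sum_divide_distrib)
      then have "(U / real k)\<^sup>2 * T = (\<Sum>r<n. (mat_vec p X u r)\<^sup>2) + real n * U\<^sup>2 / real k"
        unfolding T_def using U k by (simp add: power2_eq_square field_simps)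
      finally show ?thesis .
    qed
    ultimately show ?thesis unfolding U_def[symmetric] by (metis mult.left_commute)
  qed
qed

text \<open>
  In \<open>noise_bound_from_counts\<close> a larger \<open>k\<close> reduces the variance but allows more combinations and
  so needs a larger threshold. Balancing the two turns the family of bounds into one that is
  linear in \<open>V\<close> (the Euclidean norm \<open>|X u|\<close>) and \<open>U\<close> (\<open>sqrt n\<close> times \<open>|u|_1\<close>). The coefficient of \<open>U\<close> must
  be small, as it competes with the tuning parameter; the coefficients of \<open>V\<close> only affect the
  constants of the theorem.
\<close>

lemma choose_sample_size:
  fixes g V U L l \<sigma> :: real
  assumes \<sigma>: "0 \<le> \<sigma>" and V: "0 < V" and U: "0 \<le> U" and L: "0 \<le> L" and l: "0 \<le> l" and s: "1 \<le> s"
    and g: "\<And>k. s \<le> k \<Longrightarrow> g \<le> \<sigma> * sqrt (2 * l + 10 * real k * L) * sqrt (V\<^sup>2 + U\<^sup>2 / real k)"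
  shows "g \<le> \<sigma> * ((347/100 * sqrt l + 775/100 * sqrt (L * real s)) * V + 347/100 * sqrt L * U)"
proof -
  \<comment> \<open>The smallest admissible sample size for which the sampling variance \<open>U\<^sup>2 / k\<close> is at most \<open>5 V\<^sup>2\<close>. A factor
    above one keeps \<open>k\<close>, hence the coefficient of \<open>U\<close>, small.\<close>
  define y where "y = U\<^sup>2 / (5 * V\<^sup>2)"
  have y: "0 \<le> y" by (simp add: y_def)
  define k where "k = max s (nat \<lceil>y\<rceil>)"
  have ks: "s \<le> k" and kp: "0 < real k" using s by (auto simp: k_def)
  have yk: "y \<le> real k" unfolding k_def by linarith
  have ky: "real k \<le> real s + y" using s y unfolding k_def by linarith
  have "U\<^sup>2 \<le> 5 * V\<^sup>2 * real k"
    using yk V by (simp add: y_def field_simps)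
  then have "U\<^sup>2 / real k \<le> 5 * V\<^sup>2" using kp by (simp add: field_simps)
  then have "sqrt (V\<^sup>2 + U\<^sup>2 / real k) \<le> sqrt (6 * V\<^sup>2)" by (intro real_sqrt_le_mono) simp
  also have "\<dots> = sqrt 6 * V" using V by (simp add: real_sqrt_mult)
  finally have 1: "sqrt (V\<^sup>2 + U\<^sup>2 / real k) \<le> sqrt 6 * V" .
  have sy: "sqrt y = U / (sqrt 5 * V)" using U V by (simp add: y_def real_sqrt_divide real_sqrt_mult)
  have "sqrt (2 * l + 10 * real k * L) \<le> sqrt (2 * l) + sqrt (10 * real k * L)"
    using l L by (intro sqrt_add_le_add_sqrt) auto
  also have "sqrt (10 * real k * L) \<le> sqrt (10 * (real s + y) * L)"
    using ky L by (intro real_sqrt_le_mono mult_right_mono) auto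
  also have "\<dots> = sqrt 10 * sqrt L * sqrt (real s + y)"
    by (simp only: real_sqrt_mult mult.assoc) simp
  also have "\<dots> \<le> sqrt 10 * sqrt L * (sqrt (real s) + sqrt y)"
    using y L by (intro mult_left_mono sqrt_add_le_add_sqrt) auto
  finally have 2: "sqrt (2 * l + 10 * real k * L)
      \<le> sqrt 2 * sqrt l + sqrt 10 * sqrt L * (sqrt (real s) + U / (sqrt 5 * V))"
    by (simp add: real_sqrt_mult sy)
  have "sqrt (2 * l + 10 * real k * L) * sqrt (V\<^sup>2 + U\<^sup>2 / real k)
    \<le> (sqrt 2 * sqrt l + sqrt 10 * sqrt L * (sqrt (real s) + U / (sqrt 5 * V))) * (sqrt 6 * V)"
    using 1 2 l L V U kp by (intro mult_mono) auto
  also have "\<dots> = (sqrt 12 * sqrt l + sqrt 60 * sqrt (L * real s)) * V + sqrt 12 * sqrt L * U"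
  proof -
    \<comment> \<open>The coefficients are \<open>sqrt (2 * 6)\<close>, \<open>sqrt (10 * 6)\<close> and \<open>sqrt (10 * 6 / 5)\<close>.\<close>
    have a: "sqrt 12 = sqrt 2 * sqrt 6" "sqrt 60 = sqrt 10 * sqrt 6" 
      and b: "sqrt 10 * sqrt 6 = sqrt 5 * sqrt 12"
      by (simp_all add: real_sqrt_mult[symmetric])
    have "(sqrt 10 * sqrt L * (U / (sqrt 5 * V))) * (sqrt 6 * V) = (sqrt 10 * sqrt 6) / sqrt 5 * sqrt L * U"
      using V by simp
    also have "\<dots> = sqrt 12 * sqrt L * U" unfolding b by simp
    finally have c: "(sqrt 10 * sqrt L * (U / (sqrt 5 * V))) * (sqrt 6 * V) = sqrt 12 * sqrt L * U" .
    have "(sqrt 2 * sqrt l + sqrt 10 * sqrt L * (sqrt (real s) + U / (sqrt 5 * V))) * (sqrt 6 * V)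
      = (sqrt 2 * sqrt 6 * sqrt l + sqrt 10 * sqrt 6 * (sqrt L * sqrt (real s))) * V
         + (sqrt 10 * sqrt L * (U / (sqrt 5 * V))) * (sqrt 6 * V)"
      by (simp add: ring_distribs mult.commute mult.left_commute)
    then show ?thesis by (simp only: c a real_sqrt_mult)
  qed
  also have "\<dots> \<le> (347/100 * sqrt l + 775/100 * sqrt (L * real s)) * V + 347/100 * sqrt L * U"
  proof -
    have "sqrt 12 \<le> 347/100" "sqrt 60 \<le> 775/100"
      by (rule real_le_lsqrt; simp add: power2_eq_square)+
    then show ?thesis using V l L U
      by (intro add_mono mult_right_mono) auto
  qed
  finally have "\<sigma> * (sqrt (2 * l + 10 * real k * L) * sqrt (V\<^sup>2 + U\<^sup>2 / real k))
      \<le> \<sigma> * ((347/100 * sqrt l + 775/100 * sqrt (L * real s)) * V + 347/100 * sqrt L * U)"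
    using \<sigma> by (rule mult_left_mono)
  then show ?thesis using g[OF ks] by (simp add: mult.assoc)
qed

section \<open>Exponential tail bounds for Gaussian vectors\<close>

abbreviation std_gaussian :: "nat \<Rightarrow> (nat \<Rightarrow> real) measure" where
  "std_gaussian n \<equiv> (\<Pi>\<^sub>M i\<in>{..<n}. std_normal_distribution)"

lemma prob_space_std_normal: "prob_space std_normal_distribution"
  by (rule prob_space_normal_density) simp

lemma prob_space_std_gaussian: "prob_space (std_gaussian n)"
  by (intro prob_space_PiM prob_space_std_normal)

lemma measurable_std_gaussian [measurable_cong]:
  "sets (std_gaussian n) = sets (\<Pi>\<^sub>M i\<in>{..<n}. borel)"
  by (rule sets_PiM_cong) auto

text \<open>
  Markov's inequality for the exponential of a sum of functions of the coordinates. By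
  independence, its expectation is the product of the coordinate expectations.
\<close>

lemma product_chernoff:
  fixes f :: "nat \<Rightarrow> real \<Rightarrow> real" and K :: "nat \<Rightarrow> real"
  assumes [measurable]: "\<And>r. f r \<in> borel_measurable borel"
    and K0: "\<And>r. r < n \<Longrightarrow> 0 \<le> K r"
    and K: "\<And>r. r < n \<Longrightarrow> (\<integral>\<^sup>+x. ennreal (exp (f r x)) \<partial>std_normal_distribution) \<le> ennreal (K r)"
  shows "measure (std_gaussian n) {\<xi> \<in> space (std_gaussian n). c \<le> (\<Sum>r<n. f r (\<xi> r))}
          \<le> exp (- c) * (\<Prod>r<n. K r)"
proof -
  interpret P: prob_space "std_gaussian n" by (rule prob_space_std_gaussian)
  interpret S: product_sigma_finite "\<lambda>_::nat. std_normal_distribution"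
    unfolding product_sigma_finite_def
    using prob_space_std_normal prob_space_imp_sigma_finite by blast
  let ?A = "{\<xi> \<in> space (std_gaussian n). c \<le> (\<Sum>r<n. f r (\<xi> r))}"
  have [measurable]: "?A \<in> sets (std_gaussian n)" by measurable
  have "emeasure (std_gaussian n) ?A = (\<integral>\<^sup>+\<xi>. indicator ?A \<xi> \<partial>std_gaussian n)"
    by simp
  also have "\<dots> \<le> (\<integral>\<^sup>+\<xi>. ennreal (exp (- c)) * (\<Prod>r<n. ennreal (exp (f r (\<xi> r)))) \<partial>std_gaussian n)"
  proof (rule nn_integral_mono)
    fix \<xi>
    have "ennreal (exp (- c)) * (\<Prod>r<n. ennreal (exp (f r (\<xi> r))))
        = ennreal (exp ((\<Sum>r<n. f r (\<xi> r)) - c))"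
      by (simp add: prod_ennreal exp_sum[symmetric] ennreal_mult'[symmetric] exp_add[symmetric] exp_diff exp_minus field_simps)
    then show "indicator ?A \<xi> \<le> ennreal (exp (- c)) * (\<Prod>r<n. ennreal (exp (f r (\<xi> r))))"
      by (auto simp: indicator_def)
  qed
  also have "\<dots> = ennreal (exp (- c)) * (\<Prod>r<n. \<integral>\<^sup>+x. ennreal (exp (f r x)) \<partial>std_normal_distribution)"
    by (subst nn_integral_cmult) (simp, subst S.product_nn_integral_prod, auto)
  also have "\<dots> \<le> ennreal (exp (- c)) * (\<Prod>r<n. ennreal (K r))"
    using K by (intro mult_left_mono prod_mono_ennreal) auto
  also have "\<dots> = ennreal (exp (- c) * (\<Prod>r<n. K r))"
  proof -
    have "(\<Prod>r<n. ennreal (K r)) = ennreal (\<Prod>r<n. K r)" using K0 by (intro prod_ennreal) auto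
    then show ?thesis by (simp add: ennreal_mult')
  qed
  finally have "ennreal (measure (std_gaussian n) ?A) \<le> ennreal (exp (- c) * (\<Prod>r<n. K r))"
    by (simp add: P.emeasure_eq_measure)
  moreover have "0 \<le> exp (- c) * (\<Prod>r<n. K r)"
    using K0 by (intro mult_nonneg_nonneg prod_nonneg) auto
  ultimately show ?thesis by (simp only: ennreal_le_iff)
qed

lemma nn_integral_normal_density:
  assumes "0 < s"
  shows "(\<integral>\<^sup>+x. ennreal (normal_density m s x) \<partial>lborel) = 1"
  using assms by (subst nn_integral_eq_integral) auto

text \<open>
  Completing the square: multiplied by the exponential, the standard density becomes a multiple of
  another normal density, and the multiple is the expectation.
\<close>

lemma std_normal_exp_transform:
  assumes s: "0 < s" and K: "0 \<le> K" and f[measurable]: "f \<in> borel_measurable borel"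
    and eq: "\<And>x. std_normal_density x * exp (f x) = K * normal_density m s x"
  shows "(\<integral>\<^sup>+x. ennreal (exp (f x)) \<partial>std_normal_distribution) = ennreal K"
proof -
  have "(\<integral>\<^sup>+x. ennreal (exp (f x)) \<partial>std_normal_distribution)
      = (\<integral>\<^sup>+x. ennreal (std_normal_density x) * ennreal (exp (f x)) \<partial>lborel)"
    by (rule nn_integral_density) auto
  also have "\<dots> = (\<integral>\<^sup>+x. ennreal K * ennreal (normal_density m s x) \<partial>lborel)"
    using K by (simp add: ennreal_mult'[symmetric] eq)
  also have "\<dots> = ennreal K * (\<integral>\<^sup>+x. ennreal (normal_density m s x) \<partial>lborel)"
    by (rule nn_integral_cmult) auto
  finally show ?thesis using s by (simp add: nn_integral_normal_density)
qed

lemma std_normal_mgf: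
  "(\<integral>\<^sup>+x. ennreal (exp (t * x)) \<partial>std_normal_distribution) = ennreal (exp (t\<^sup>2 / 2))"
proof (rule std_normal_exp_transform[where m = t and s = 1])
  fix x :: real
  have "- x\<^sup>2 / 2 + t * x = t\<^sup>2 / 2 + - (x - t)\<^sup>2 / 2"
    by (simp add: power2_eq_square field_simps)
  then have "exp (- x\<^sup>2 / 2) * exp (t * x) = exp (t\<^sup>2 / 2) * exp (- (x - t)\<^sup>2 / 2)"
    by (simp only: exp_add[symmetric])
  then show "std_normal_density x * exp (t * x) = exp (t\<^sup>2 / 2) * normal_density t 1 x"
    by (simp add: std_normal_density_def normal_density_def)
qed auto

lemma std_normal_square_mgf_neg:
  "(\<integral>\<^sup>+x. ennreal (exp (- x\<^sup>2 / 2)) \<partial>std_normal_distribution) = ennreal (1 / sqrt 2)"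
proof (rule std_normal_exp_transform[where m = 0 and s = "1 / sqrt 2"])
  fix x :: real
  have "exp (- x\<^sup>2 / 2) * exp (- x\<^sup>2 / 2) = exp (- x\<^sup>2)" by (simp add: exp_add[symmetric])
  then show "std_normal_density x * exp (- x\<^sup>2 / 2) = 1 / sqrt 2 * normal_density 0 (1 / sqrt 2) x"
    by (simp add: std_normal_density_def normal_density_def power_divide real_sqrt_mult)
qed auto

lemma std_normal_square_mgf_pos:
  "(\<integral>\<^sup>+x. ennreal (exp (x\<^sup>2 / 4)) \<partial>std_normal_distribution) = ennreal (sqrt 2)"
proof (rule std_normal_exp_transform[where m = 0 and s = "sqrt 2"])
  fix x :: real
  have "exp (- x\<^sup>2 / 2) * exp (x\<^sup>2 / 4) = exp (- x\<^sup>2 / 4)" by (simp add: exp_add[symmetric])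
  then show "std_normal_density x * exp (x\<^sup>2 / 4) = sqrt 2 * normal_density 0 (sqrt 2) x"
    by (simp add: std_normal_density_def normal_density_def real_sqrt_mult field_simps)
qed auto

lemma sqrt2_power: "sqrt 2 ^ n = exp (real n * (ln 2 / 2))"
  by (simp add: exp_of_nat_mult ln_sqrt[symmetric])

text \<open>
  Testing with \<open>exp (- x\<^sup>2 / 2)\<close>, the exponent per coordinate is \<open>1/4 - (ln 2) / 2 < - 1/24\<close>.
\<close>

lemma chi_square_lower_tail:
  "measure (std_gaussian n) {\<xi> \<in> space (std_gaussian n). (\<Sum>r<n. (\<xi> r)\<^sup>2) < real n / 2}
     \<le> exp (- real n / 24)"
proof -
  interpret P: prob_space "std_gaussian n" by (rule prob_space_std_gaussian)
  have "measure (std_gaussian n) {\<xi> \<in> space (std_gaussian n). (\<Sum>r<n. (\<xi> r)\<^sup>2) < real n / 2}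
     \<le> measure (std_gaussian n) {\<xi> \<in> space (std_gaussian n). - (real n / 4) \<le> (\<Sum>r<n. - (\<xi> r)\<^sup>2 / 2)}"
    by (rule P.finite_measure_mono) (auto simp: sum_divide_distrib[symmetric] sum_negf)
  also have "\<dots> \<le> exp (- (- (real n / 4))) * (\<Prod>r<n. 1 / sqrt 2)"
    by (rule product_chernoff) (simp_all only: std_normal_square_mgf_neg, auto)
  also have "\<dots> = exp (real n / 4 - real n * (ln 2 / 2))"
    by (simp add: power_divide sqrt2_power exp_diff)
  also have "\<dots> \<le> exp (- real n / 24)"
  proof -
    have "real n * (7 / 24) \<le> real n * (ln 2 / 2)"
      using ln2_ge_two_thirds by (intro mult_left_mono) auto
    then show ?thesis by simp
  qed
  finally show ?thesis .
qed

text \<open>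
  Testing with \<open>exp (x\<^sup>2 / 4)\<close>, the exponent per coordinate is \<open>(ln 2) / 2 - 1/2 < - 1/24\<close>.
\<close>

lemma chi_square_upper_tail:
  "measure (std_gaussian n) {\<xi> \<in> space (std_gaussian n). 2 * real n < (\<Sum>r<n. (\<xi> r)\<^sup>2)}
     \<le> exp (- real n / 24)"
proof -
  interpret P: prob_space "std_gaussian n" by (rule prob_space_std_gaussian)
  have "measure (std_gaussian n) {\<xi> \<in> space (std_gaussian n). 2 * real n < (\<Sum>r<n. (\<xi> r)\<^sup>2)}
     \<le> measure (std_gaussian n) {\<xi> \<in> space (std_gaussian n). real n / 2 \<le> (\<Sum>r<n. (\<xi> r)\<^sup>2 / 4)}"
    by (rule P.finite_measure_mono) (auto simp: sum_divide_distrib[symmetric])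
  also have "\<dots> \<le> exp (- (real n / 2)) * (\<Prod>r<n. sqrt 2)"
    by (rule product_chernoff) (simp_all add: std_normal_square_mgf_pos)
  also have "\<dots> = exp (- (real n / 2) + real n * (ln 2 / 2))"
    by (simp add: sqrt2_power exp_add[symmetric])
  also have "\<dots> \<le> exp (- real n / 24)"
  proof -
    have "real n * (ln 2 / 2) \<le> real n * (11 / 24)"
      using ln2_le_25_over_36 by (intro mult_left_mono) auto
    then show ?thesis by simp
  qed
  finally show ?thesis .
qed

lemma linear_form_tail:
  assumes a: "0 \<le> a"
  shows "measure (std_gaussian n) {\<xi> \<in> space (std_gaussian n).
      a * sqrt (\<Sum>r<n. (v r)\<^sup>2) < (\<Sum>r<n. \<xi> r * v r)} \<le> exp (- a\<^sup>2 / 2)"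
proof (cases "(\<Sum>r<n. (v r)\<^sup>2) = 0")
  case True
  then have "v r = 0" if "r < n" for r using that by (simp add: sum_nonneg_eq_0_iff)
  then show ?thesis by simp
next
  case False
  interpret P: prob_space "std_gaussian n" by (rule prob_space_std_gaussian)
  define V where "V = sqrt (\<Sum>r<n. (v r)\<^sup>2)"
  have V: "0 < V" using False unfolding V_def by (simp add: less_le sum_nonneg)
  have V2: "V\<^sup>2 = (\<Sum>r<n. (v r)\<^sup>2)" unfolding V_def by (simp add: sum_nonneg)
  \<comment> \<open>Exponential Markov with the optimal parameter \<open>a / V\<close>.\<close>
  have "measure (std_gaussian n) {\<xi> \<in> space (std_gaussian n). a * V < (\<Sum>r<n. \<xi> r * v r)}
     \<le> measure (std_gaussian n) {\<xi> \<in> space (std_gaussian n). a\<^sup>2 \<le> (\<Sum>r<n. (a * v r / V) * \<xi> r)}"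
  proof (rule P.finite_measure_mono)
    have "a\<^sup>2 \<le> (\<Sum>r<n. (a * v r / V) * \<xi> r)" if "a * V < (\<Sum>r<n. \<xi> r * v r)" for \<xi>
    proof -
      have "a\<^sup>2 = a / V * (a * V)" using V by (simp add: power2_eq_square)
      also have "\<dots> \<le> a / V * (\<Sum>r<n. \<xi> r * v r)"
        using that a V by (intro mult_left_mono) auto
      also have "\<dots> = (\<Sum>r<n. (a * v r / V) * \<xi> r)"
        by (simp add: sum_distrib_left mult.commute mult.left_commute)
      finally show ?thesis .
    qed
    then show "{\<xi> \<in> space (std_gaussian n). a * V < (\<Sum>r<n. \<xi> r * v r)}
      \<subseteq> {\<xi> \<in> space (std_gaussian n). a\<^sup>2 \<le> (\<Sum>r<n. (a * v r / V) * \<xi> r)}" by blast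
  qed measurable
  also have "\<dots> \<le> exp (- (a\<^sup>2)) * (\<Prod>r<n. exp ((a * v r / V)\<^sup>2 / 2))"
    by (rule product_chernoff) (simp_all only: std_normal_mgf, auto)
  also have "(\<Prod>r<n. exp ((a * v r / V)\<^sup>2 / 2)) = exp (\<Sum>r<n. (a * v r / V)\<^sup>2 / 2)"
    by (simp add: exp_sum)
  also have "(\<Sum>r<n. (a * v r / V)\<^sup>2 / 2) = a\<^sup>2 / V\<^sup>2 / 2 * (\<Sum>r<n. (v r)\<^sup>2)"
    by (simp add: sum_distrib_left power_mult_distrib power_divide)
  also have "\<dots> = a\<^sup>2 / 2" using V unfolding V2[symmetric] by simp
  also have "exp (- (a\<^sup>2)) * exp (a\<^sup>2 / 2) = exp (- a\<^sup>2 / 2)" by (simp add: exp_add[symmetric])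
  finally show ?thesis unfolding V_def .
qed

section \<open>A union bound over all integer combinations\<close>

text \<open>
  Stars and bars, followed by \<open>k! \<ge> (k / e)^k\<close>.
\<close>

lemma card_count_lists_le:
  assumes k: "1 \<le> k"
  shows "real (card {l::nat list. length l = m \<and> sum_list l = k}) \<le> (exp 1 * ((real k + real m) / real k)) ^ k"
proof -
  have "real ((k + m - 1) choose k) * fact k \<le> real ((k + m - 1) ^ k)"
    using binomial_fact_pow[of "k + m - 1" k] by (metis of_nat_fact of_nat_le_iff of_nat_mult)
  also have "\<dots> \<le> (real k + real m) ^ k"
    by (simp flip: of_nat_add of_nat_power) (rule power_mono, auto)
  finally have 1: "real ((k + m - 1) choose k) \<le> (real k + real m) ^ k / fact k"
    by (simp add: field_simps)
  have "real k ^ k / fact k \<le> exp (real k)"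
  proof -
    have "(\<Sum>i\<in>{k}. inverse (fact i) *\<^sub>R real k ^ i) \<le> (\<Sum>i. inverse (fact i) *\<^sub>R real k ^ i)"
      by (rule sum_le_suminf) (use summable_exp[of "real k"] in auto)
    then show ?thesis by (simp add: exp_def field_simps)
  qed
  then have "1 / fact k \<le> exp 1 ^ k / real k ^ k"
    using k by (simp add: field_simps exp_of_nat_mult[symmetric] flip: exp_of_nat_mult)
  then have "(real k + real m) ^ k * (1 / fact k) \<le> (real k + real m) ^ k * (exp 1 ^ k / real k ^ k)"
    by (intro mult_left_mono) auto
  then show ?thesis using 1
    by (simp add: card_length_sum_list power_mult_distrib power_divide mult.commute)
qed

text \<open>
  The union bound for combinations with \<open>k\<close> terms. With \<open>x = 2 p / s \<ge> 2\<close> there are at most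
  \<open>(e (1 + x))^k\<close> of them because \<open>k \<ge> s\<close>, whereas the tail contributes \<open>\<delta>0 x^(- 5 k)\<close>.
\<close>

lemma count_vs_tail:
  assumes s: "1 \<le> s" and sp: "s \<le> p" and k: "s \<le> k" and d: "0 < \<delta>0" "\<delta>0 \<le> 1"
  shows "real (card {l::nat list. length l = 2 * p \<and> sum_list l = k})
     * exp (- (sqrt (2 * ln (1 / \<delta>0) + 10 * real k * ln (2 * real p / real s)))\<^sup>2 / 2)
     \<le> \<delta>0 * (1/2) ^ k"
proof -
  define x where "x = 2 * real p / real s"
  have x2: "2 \<le> x" using s sp by (simp add: x_def field_simps)
  have k1: "1 \<le> k" using s k by simp
  have l0: "0 \<le> ln (1 / \<delta>0)" using d by simp
  have lx: "0 \<le> ln x" using x2 by simp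
  have "(sqrt (2 * ln (1 / \<delta>0) + 10 * real k * ln x))\<^sup>2 = 2 * ln (1 / \<delta>0) + 10 * real k * ln x"
    using l0 lx by simp
  then have "exp (- (sqrt (2 * ln (1 / \<delta>0) + 10 * real k * ln x))\<^sup>2 / 2)
     = exp (ln \<delta>0 + - (real k * ln (x ^ 5)))"
    using d x2 by (simp add: ln_div ln_realpow algebra_simps)
  also have "\<dots> = \<delta>0 * (1 / x ^ 5) ^ k"
  proof -
    have "exp (real k * ln (x ^ 5)) = exp (ln (x ^ 5)) ^ k" by (rule exp_of_nat_mult)
    also have "exp (ln (x ^ 5)) = x ^ 5" using x2 by (intro exp_ln) simp
    finally show ?thesis using d by (simp only: exp_add exp_minus exp_ln power_one_over divide_inverse) (simp add: power_inverse)
  qed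
  finally have tail: "exp (- (sqrt (2 * ln (1 / \<delta>0) + 10 * real k * ln x))\<^sup>2 / 2) = \<delta>0 * (1 / x ^ 5) ^ k" .
  have "real (card {l::nat list. length l = 2 * p \<and> sum_list l = k})
      \<le> (exp 1 * ((real k + real (2 * p)) / real k)) ^ k"
    by (rule card_count_lists_le[OF k1])
  \<comment> \<open>\<open>e (1 + x) \<le> 3 * (3/2) x\<close>, and this is at most \<open>x ^ 5 / 2\<close> because \<open>x ^ 4 \<ge> 2 ^ 4 \<ge> 9\<close>.\<close>
  also have "\<dots> \<le> (x ^ 5 / 2) ^ k"
  proof (rule power_mono)
    have "2 * real p / real k \<le> x" unfolding x_def using s k by (intro divide_left_mono) auto
    then have "(real k + real (2 * p)) / real k \<le> 1 + x" using k1 by (simp add: add_divide_distrib)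
    also have "\<dots> \<le> 3/2 * x" using x2 by simp
    finally have "exp 1 * ((real k + real (2 * p)) / real k) \<le> 3 * (3/2 * x)"
      using exp_le x2 by (intro mult_mono) auto
    also have "\<dots> \<le> x ^ 4 / 2 * x"
    proof -
      have "(2::real) ^ 4 \<le> x ^ 4" using x2 by (intro power_mono) auto
      then have "16 * x \<le> x ^ 4 * x" using x2 by (intro mult_right_mono) auto
      then show ?thesis using x2 by simp
    qed
    also have "\<dots> = x ^ 5 / 2" by (simp add: eval_nat_numeral)
    finally show "exp 1 * ((real k + real (2 * p)) / real k) \<le> x ^ 5 / 2" .
  qed auto
  finally have "real (card {l::nat list. length l = 2 * p \<and> sum_list l = k}) * (\<delta>0 * (1 / x ^ 5) ^ k)
      \<le> (x ^ 5 / 2) ^ k * (\<delta>0 * (1 / x ^ 5) ^ k)"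
    using d x2 by (intro mult_right_mono) auto
  also have "\<dots> = \<delta>0 * (1/2) ^ k"
    using x2 by (simp add: power_divide)
  finally show ?thesis unfolding x_def[symmetric] tail .
qed

text \<open>
  Outside an event of probability \<open>\<delta>0\<close>, the threshold is respected by all integer combinations
  with at least \<open>s\<close> terms.
\<close>

lemma uniform_count_event:
  fixes X :: "nat \<Rightarrow> nat \<Rightarrow> real" and n p s :: nat and \<delta>0 :: real
  assumes s: "1 \<le> s" and sp: "s \<le> p" and d: "0 < \<delta>0" "\<delta>0 \<le> 1"
  defines "bad \<equiv> {\<xi> \<in> space (std_gaussian n). \<exists>k\<ge>s. \<exists>l. length l = 2 * p \<and> sum_list l = k \<and>
     sqrt (2 * ln (1 / \<delta>0) + 10 * real k * ln (2 * real p / real s))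
        * sqrt (\<Sum>r<n. (column_comb p X l r)\<^sup>2) < (\<Sum>r<n. \<xi> r * column_comb p X l r)}"
  shows "bad \<in> sets (std_gaussian n)" and "measure (std_gaussian n) bad \<le> \<delta>0"
proof -
  interpret P: prob_space "std_gaussian n" by (rule prob_space_std_gaussian)
  define thr where "thr k = sqrt (2 * ln (1 / \<delta>0) + 10 * real k * ln (2 * real p / real s))" for k
  define Ls where "Ls k = {l::nat list. length l = 2 * p \<and> sum_list l = k}" for k
  define B where "B l = {\<xi> \<in> space (std_gaussian n).
     thr (sum_list l) * sqrt (\<Sum>r<n. (column_comb p X l r)\<^sup>2) < (\<Sum>r<n. \<xi> r * column_comb p X l r)}" for l
  \<comment> \<open>Grouped by the total \<open>s + i\<close>, the exceptional probabilities are dominated by a geometric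
    series with sum \<open>\<delta>0\<close>; as \<open>s \<ge> 1\<close>, its exponents may be taken to start at one.\<close>
  define A where "A i = (\<Union>l\<in>Ls (s + i). B l)" for i
  have finL: "finite (Ls k)" for k
  proof (rule finite_subset)
    show "Ls k \<subseteq> {l. set l \<subseteq> {..k} \<and> length l = 2 * p}"
      by (auto simp: Ls_def member_le_sum_list)
    show "finite {l. set l \<subseteq> {..k} \<and> length l = 2 * p}" by (rule finite_lists_length_eq) simp
  qed
  have B_sets[measurable]: "B l \<in> sets (std_gaussian n)" for l unfolding B_def by measurable
  have A_sets[measurable]: "A i \<in> sets (std_gaussian n)" for i
    unfolding A_def using finL by (intro sets.finite_UN) auto
  have bad: "bad = (\<Union>i. A i)"
  proof -
    have "(\<exists>k\<ge>s. Q k) \<longleftrightarrow> (\<exists>i. Q (s + i))" for Q using le_Suc_ex le_add1 by metis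
    then show ?thesis unfolding bad_def A_def B_def Ls_def thr_def by auto
  qed
  show "bad \<in> sets (std_gaussian n)" unfolding bad by measurable
  have thr0: "0 \<le> thr k" for k
  proof -
    have "0 \<le> ln (1 / \<delta>0)" using d by simp
    moreover have "0 \<le> ln (2 * real p / real s)" using s sp by (simp add: field_simps)
    ultimately show ?thesis unfolding thr_def by simp
  qed
  have mA: "measure (std_gaussian n) (A i) \<le> \<delta>0 * (1/2) ^ Suc i" for i
  proof -
    have "measure (std_gaussian n) (A i) \<le> (\<Sum>l\<in>Ls (s + i). measure (std_gaussian n) (B l))"
      unfolding A_def using finL by (intro P.finite_measure_subadditive_finite) auto
    also have "\<dots> \<le> (\<Sum>l\<in>Ls (s + i). exp (- (thr (s + i))\<^sup>2 / 2))"
    proof (rule sum_mono)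
      fix l assume "l \<in> Ls (s + i)"
      then have "sum_list l = s + i" by (simp add: Ls_def)
      then show "measure (std_gaussian n) (B l) \<le> exp (- (thr (s + i))\<^sup>2 / 2)"
        unfolding B_def using linear_form_tail[OF thr0] by simp
    qed
    also have "\<dots> = real (card (Ls (s + i))) * exp (- (thr (s + i))\<^sup>2 / 2)" by simp
    also have "\<dots> \<le> \<delta>0 * (1/2) ^ (s + i)"
      unfolding Ls_def thr_def by (rule count_vs_tail[OF s sp _ d]) simp
    also have "\<dots> \<le> \<delta>0 * (1/2) ^ Suc i"
      using d s by (intro mult_left_mono power_decreasing) auto
    finally show ?thesis .
  qed
  have geo: "(\<lambda>i. \<delta>0 * (1/2) ^ Suc i) sums \<delta>0"
    using sums_mult[OF power_half_series, of \<delta>0] by simp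
  have summ: "summable (\<lambda>i. measure (std_gaussian n) (A i))"
    by (rule summable_comparison_test'[OF sums_summable[OF geo], of 0]) (use mA in auto)
  have "measure (std_gaussian n) bad \<le> (\<Sum>i. measure (std_gaussian n) (A i))"
    unfolding bad using summ by (intro P.finite_measure_subadditive_countably) auto
  also have "\<dots> \<le> (\<Sum>i. \<delta>0 * (1/2) ^ Suc i)"
    by (rule suminf_le[OF mA summ sums_summable[OF geo]])
  also have "\<dots> = \<delta>0" using geo by (rule sums_unique[symmetric])
  finally show "measure (std_gaussian n) bad \<le> \<delta>0" .
qed

section \<open>Deterministic analysis of the Square-Root Lasso\<close>

text \<open>
  The deterministic heart of the proof, stated for real numbers. In the application \<open>N\<close> and \<open>Qh\<close>
  are the residual norms at \<open>\<beta>\<close> and at the estimator, \<open>P\<close> is the prediction error, \<open>l\<close> the tuning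
  parameter, \<open>d = |\<beta>|_1 - |\<beta>hat|_1\<close>, \<open>U = US + UC\<close> splits \<open>|u|_1\<close> along the support of \<open>\<beta>\<close>,
  \<open>W = sqrt s |u|_2\<close>, \<open>k = \<kappa> / sqrt s\<close>, and \<open>cross\<close> is the empirical inner product of the noise
  with \<open>X u\<close>. The first alternative of the conclusion is the case in which \<open>u\<close> lies in the cone,
  the second the case in which the deviation term \<open>\<tau> P\<close> dominates.
\<close>

lemma basic_inequality_dichotomy:
  fixes N Qh P U US UC W d \<tau> \<eta> l k cross :: real
  assumes N: "0 \<le> N" and Qh: "0 \<le> Qh" and P: "0 \<le> P" and l: "0 < l" and k: "0 < k"
    and lk: "16 * l \<le> 3 * k" and \<eta>: "0 \<le> \<eta>" "\<eta> \<le> 23/100" and \<tau>: "0 \<le> \<tau>"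
    and basic: "Qh - N \<le> l * d" and d: "d \<le> US - UC" and U: "U = US + UC" and UC: "0 \<le> UC"
    and US: "0 \<le> US" "US \<le> W"
    and cross: "cross \<le> N * (\<tau> * P + \<eta> * (l * U))"
    and pyth: "Qh\<^sup>2 = N\<^sup>2 - 2 * cross + P\<^sup>2"
    and cs: "N\<^sup>2 - cross \<le> Qh * N"
    and cone: "3 * U \<le> 8 * W \<Longrightarrow> k * W \<le> P"
  shows "(k * P \<le> 4 * N * l \<and> k * W \<le> P \<and> 3 * U \<le> 8 * W)
       \<or> (P \<le> 70 * N * \<tau> \<and> l * U \<le> 54 * \<tau> * P \<and> l * W \<le> 20 * \<tau> * P)"
proof -
  have W: "0 \<le> W" using US by simp
  have U0: "0 \<le> U" using U US UC by simp
  have lW: "0 \<le> l * W" and lU: "0 \<le> l * U" and tP: "0 \<le> \<tau> * P"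
    using l W U0 \<tau> P by simp_all
  \<comment> \<open>Convexity of the residual norm at the truth; when \<open>N = 0\<close> it degenerates to \<open>0 \<le> Qh\<close>.\<close>
  have low: "- (\<tau> * P + \<eta> * (l * U)) \<le> Qh - N"
  proof (cases "N = 0")
    case True
    then show ?thesis using Qh tP mult_nonneg_nonneg[OF \<eta>(1) lU] by simp
  next
    case False
    then have "N > 0" using N by simp
    have "N * (N - (\<tau> * P + \<eta> * (l * U))) \<le> N * Qh"
      using cs cross by (simp add: algebra_simps power2_eq_square)
    then show ?thesis using \<open>N > 0\<close> by simp
  qed
  have ld: "l * d \<le> l * US - l * UC"
    using mult_left_mono[OF d, of l] l by (simp add: algebra_simps)
  have lUS: "l * US \<le> l * W" using US l by simp
  have lUC: "0 \<le> l * UC" using UC l by simp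
  have lUeq: "l * U = l * US + l * UC" using U by (simp add: algebra_simps)
  have \<eta>lU: "\<eta> * (l * U) \<le> 23/100 * (l * U)" using \<eta> lU by (intro mult_right_mono) auto
  have Ubound: "77/100 * (l * U) \<le> 2 * (l * W) + \<tau> * P"
    using low basic ld lUS lUeq \<eta>lU by simp
  have Q2: "P\<^sup>2 = (Qh - N) * (Qh + N) + 2 * cross"
    using pyth by (simp add: power2_eq_square algebra_simps)
  \<comment> \<open>The term \<open>(l d)\<^sup>2\<close> arises only when \<open>d > 0\<close>. Then \<open>UC \<le> US\<close>, so the error is in the cone,
    and \<open>l W \<le> 3/16 P\<close> lets the left-hand side absorb it: \<open>247/256 = 1 - (3/16)\<^sup>2\<close>.\<close>
  have quad: "P\<^sup>2 * (247/256) \<le> 2 * N * (l * W + (\<tau> * P + 23/100 * (l * U)))"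
  proof -
    have cr: "cross \<le> N * (\<tau> * P + 23/100 * (l * U))"
    proof -
      have "N * (\<tau> * P + \<eta> * (l * U)) \<le> N * (\<tau> * P + 23/100 * (l * U))"
        using N \<eta>lU by (intro mult_left_mono) auto
      then show ?thesis using cross by simp
    qed
    have NlW: "0 \<le> N * (l * W)" using N lW by simp
    show ?thesis
    proof (cases "Qh \<le> N")
      case True
      have "(Qh - N) * (Qh + N) \<le> 0" using True N Qh by (intro mult_nonpos_nonneg) auto
      then have "P\<^sup>2 * (247/256) \<le> 2 * cross" using Q2 zero_le_power2[of P] by linarith
      then show ?thesis using cr NlW by (simp add: algebra_simps)
    next
      case False
      then have dpos: "0 < l * d" using basic by simp
      then have "l * UC \<le> l * US" using ld by simp
      then have "UC \<le> US" using l by simp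
      then have "3 * U \<le> 8 * W" using U US UC by simp
      then have kW: "k * W \<le> P" by (rule cone)
      have "16 * l * W \<le> 3 * k * W" using lk W by (intro mult_right_mono) auto
      then have lWP: "l * W \<le> 3/16 * P" using kW by simp
      have ldW: "l * d \<le> l * W" using ld lUC lUS by simp
      have "(Qh - N) * (Qh + N) \<le> (l * W) * (2 * N + l * W)"
        using basic ldW False N Qh by (intro mult_mono) auto
      also have "\<dots> = 2 * N * (l * W) + (l * W)\<^sup>2" by (simp add: power2_eq_square algebra_simps)
      also have "(l * W)\<^sup>2 \<le> (3/16 * P)\<^sup>2" using lWP lW by (intro power_mono) auto
      finally have "P\<^sup>2 \<le> 2 * N * (l * W) + (3/16 * P)\<^sup>2 + 2 * cross" using Q2 by simp
      then show ?thesis using cr by (simp add: algebra_simps power2_eq_square)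
    qed
  qed
  show ?thesis
  \<comment> \<open>The threshold \<open>1/20\<close> leaves just enough room for the cone inequality:
      \<open>(2 + 1/20) / (77/100) \<le> 8/3\<close>.\<close>
  proof (cases "20 * (\<tau> * P) \<le> l * W")
    case True
    have lU2: "l * U \<le> 8/3 * (l * W)" using Ubound True lW by simp
    then have "l * (3 * U) \<le> l * (8 * W)" by simp
    then have UW: "3 * U \<le> 8 * W" using l by simp
    then have kW: "k * W \<le> P" by (rule cone)
    have "l * W + (\<tau> * P + 23/100 * (l * U)) \<le> 5/3 * (l * W)"
      using True lU2 lW by linarith
    then have "2 * N * (l * W + (\<tau> * P + 23/100 * (l * U))) \<le> 2 * N * (5/3 * (l * W))"
      using N by (intro mult_left_mono) auto
    moreover have "0 \<le> N * (l * W)" using N lW by simp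
    moreover have "2 * N * (5/3 * (l * W)) = 10/3 * (N * (l * W))" by simp
    ultimately have "P\<^sup>2 \<le> 4 * (N * (l * W))" using quad by linarith
    then have "P\<^sup>2 \<le> 4 * N * (l * W)" by simp
    then have "k * P\<^sup>2 \<le> k * (4 * N * (l * W))" using k by simp
    also have "\<dots> = (4 * N * l) * (k * W)" by simp
    also have "\<dots> \<le> (4 * N * l) * P" using kW N l by (intro mult_left_mono) auto
    finally have "P * (k * P) \<le> P * (4 * N * l)" by (simp add: power2_eq_square algebra_simps)
    then have "k * P \<le> 4 * N * l"
      using P N l by (cases "P = 0") auto
    then show ?thesis using kW UW by simp
  next
    case False
    then have lW20: "l * W \<le> 20 * (\<tau> * P)" by simp
    have lU54: "l * U \<le> 54 * (\<tau> * P)" using Ubound lW20 tP by simp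
    have "l * W + (\<tau> * P + 23/100 * (l * U)) \<le> 3342/100 * (\<tau> * P)"
      using lW20 lU54 by linarith
    then have "2 * N * (l * W + (\<tau> * P + 23/100 * (l * U))) \<le> 2 * N * (3342/100 * (\<tau> * P))"
      using N by (intro mult_left_mono) auto
    moreover have "0 \<le> N * (\<tau> * P)" using N tP by simp
    moreover have "2 * N * (3342/100 * (\<tau> * P)) = 3342/50 * (N * (\<tau> * P))" by simp
    ultimately have "P\<^sup>2 \<le> 70 * (N * (\<tau> * P))" using quad by linarith
    then have "P * P \<le> P * (70 * N * \<tau>)" by (simp add: power2_eq_square algebra_simps)
    then have "P \<le> 70 * N * \<tau>"
      using P N \<tau> by (cases "P = 0") auto
    then show ?thesis using lW20 lU54 by simp
  qed
qed

text \<open>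
  Consequences of the good event for one realisation of the data. The radius \<open>R\<close> is scaled so
  that \<open>|u|_1 \<le> s R\<close> and \<open>|u|_2 \<le> sqrt s R\<close>, as required for interpolation. The two alternatives
  are those of \<open>basic_inequality_dichotomy\<close>; in the second one \<open>R\<close> is of order \<open>\<tau>\<^sup>2 / (s lam)\<close>, which explains the
  squared logarithm of \<open>1 / \<delta>0\<close> in \<open>w\<close>.
\<close>

lemma sqrt_lasso_deterministic:
  fixes \<gamma> \<sigma> \<kappa> lam L ell :: real
  assumes \<gamma>: "16 + 4 * sqrt 2 \<le> \<gamma>" and n: "1 \<le> n" and s: "1 \<le> s" and sp: "s \<le> p"
    and \<sigma>: "0 \<le> \<sigma>" and sre: "SRE n p X s (5/3)" and \<kappa>: "\<kappa> = sre_kappa n p X s (5/3)"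
    and L: "L = ln (2 * real p / real s)"
    and lam: "lam = \<gamma> * sqrt (1 / real n * L)"
    and small: "real s / real n * L \<le> 9 * \<kappa>\<^sup>2 / (256 * \<gamma>\<^sup>2)"
    and b: "b \<in> sqrt_lasso n p X lam y" and \<beta>: "l0_norm p \<beta> \<le> s" and ell: "0 \<le> ell"
    and \<epsilon>: "\<And>i. \<epsilon> i = y i - mat_vec p X \<beta> i"
    and low: "\<sigma>\<^sup>2 * (real n / 2) \<le> (\<Sum>i<n. (\<epsilon> i)\<^sup>2)"
    and up: "(\<Sum>i<n. (\<epsilon> i)\<^sup>2) \<le> \<sigma>\<^sup>2 * (2 * real n)"
    and ev: "\<And>k l. s \<le> k \<Longrightarrow> length l = 2 * p \<Longrightarrow> sum_list l = k \<Longrightarrow>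
       (\<Sum>i<n. \<epsilon> i * column_comb p X l i)
         \<le> \<sigma> * sqrt (2 * ell + 10 * real k * L) * sqrt (\<Sum>i<n. (column_comb p X l i)\<^sup>2)"
  defines "u \<equiv> \<lambda>j. b j - \<beta> j"
    and "h \<equiv> sqrt (real s / real n * L)" and "g \<equiv> sqrt (ell / real n)"
    and "r \<equiv> sqrt (1 / real n * L)" and "w \<equiv> sqrt (ell\<^sup>2 / (real n * L))"
  shows "\<exists>R. 0 \<le> R \<and> lq_norm p 1 u \<le> real s * R \<and> sqrt (real s) * lq_norm p 2 u \<le> real s * R
     \<and> (emp_norm n (mat_vec p X u) \<le> \<sigma> * (6 * \<gamma> / \<kappa>\<^sup>2 * h) \<and> R \<le> \<sigma> * (16 * \<gamma> / \<kappa>\<^sup>2 * r)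
      \<or> emp_norm n (mat_vec p X u) \<le> \<sigma> * (1100 * h + 500 * g)
          \<and> R \<le> \<sigma> * (1306800 * r + 270000 * (w / real s)))"
proof -
  have n0: "0 < real n" and s0: "0 < real s" using n s by simp_all
  have "2 \<le> 2 * real p / real s" using s sp by (simp add: field_simps)
  then have Lp: "0 < L" unfolding L by (intro ln_gt_zero) auto
  have "1414/1000 \<le> sqrt (2::real)" by (rule real_le_rsqrt) (simp add: power2_eq_square)
  then have \<gamma>b: "21656/1000 \<le> \<gamma>" using \<gamma> by linarith
  have \<kappa>0: "0 < \<kappa>" using sre \<kappa> by (simp add: SRE_def)
  have \<kappa>1: "\<kappa> \<le> 1" using sre_kappa_le_1[OF sre] s sp \<kappa> by simp
  have r0: "0 < r" using n0 Lp by (simp add: r_def)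
  have lamr: "lam = \<gamma> * r" by (simp add: lam r_def)
  have lam0: "0 < lam" using lamr r0 \<gamma>b by simp
  have h0: "0 \<le> h" and g0: "0 \<le> g" using n0 s0 Lp ell by (simp_all add: h_def g_def)
  have hr: "h = sqrt (real s) * r" by (simp add: h_def r_def real_sqrt_mult[symmetric])
  define xu where "xu i = mat_vec p X u i" for i
  define N where "N = sqrt (\<Sum>i<n. (\<epsilon> i)\<^sup>2) / sqrt (real n)"
  define Qh where "Qh = sqrt (\<Sum>i<n. (\<epsilon> i - xu i)\<^sup>2) / sqrt (real n)"
  define P where "P = sqrt (\<Sum>i<n. (xu i)\<^sup>2) / sqrt (real n)"
  define cross where "cross = (\<Sum>i<n. \<epsilon> i * xu i) / real n"
  define S where "S = {j. j < p \<and> \<beta> j \<noteq> 0}"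
  define US where "US = (\<Sum>j\<in>S. \<bar>u j\<bar>)"
  define UC where "UC = (\<Sum>j\<in>{..<p} - S. \<bar>u j\<bar>)"
  define U where "U = (\<Sum>j<p. \<bar>u j\<bar>)"
  define U2 where "U2 = sqrt (\<Sum>j<p. (u j)\<^sup>2)"
  define W where "W = sqrt (real s) * U2"
  define d where "d = (\<Sum>j<p. \<bar>\<beta> j\<bar>) - (\<Sum>j<p. \<bar>b j\<bar>)"
  have P_emp: "emp_norm n (mat_vec p X u) = P" by (simp add: emp_norm_eq P_def xu_def)
  have N0: "0 \<le> N" and Q0: "0 \<le> Qh" and P0: "0 \<le> P" and U0: "0 \<le> U" and W0: "0 \<le> W"
    by (simp_all add: N_def Qh_def P_def U_def W_def U2_def sum_nonneg)
  have S_fin: "finite S" "S \<subseteq> {..<p}" "card S \<le> s"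
    using \<beta> by (auto simp: S_def l0_norm_def)
  have U_split: "U = US + UC"
    unfolding U_def US_def UC_def using S_fin by (subst sum.subset_diff[of S]) auto
  have N2: "N\<^sup>2 = (\<Sum>i<n. (\<epsilon> i)\<^sup>2) / real n" by (simp add: N_def power_divide sum_nonneg)
  have Qh2: "Qh\<^sup>2 = (\<Sum>i<n. (\<epsilon> i - xu i)\<^sup>2) / real n" by (simp add: Qh_def power_divide sum_nonneg)
  have P2: "P\<^sup>2 = (\<Sum>i<n. (xu i)\<^sup>2) / real n" by (simp add: P_def power_divide sum_nonneg)
  have basic: "Qh - N \<le> lam * d"
  proof -
    let ?obj = "\<lambda>\<beta>. (1 / sqrt (real n)) * lq_norm n 2 (\<lambda>i. y i - mat_vec p X \<beta> i) + lam * lq_norm p 1 \<beta>"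
    have "?obj b \<le> ?obj \<beta>"
      using b by (auto simp: sqrt_lasso_def is_arg_min_def not_less)
    moreover have "(\<lambda>i. y i - mat_vec p X b i) = (\<lambda>i. \<epsilon> i - xu i)"
      by (rule ext) (simp add: \<epsilon> xu_def u_def mat_vec_def sum_subtractf right_diff_distrib)
    moreover have "(\<lambda>i. y i - mat_vec p X \<beta> i) = \<epsilon>" using \<epsilon> by auto
    ultimately show ?thesis
      by (simp add: lq_norm_1 lq_norm_2 Qh_def N_def d_def algebra_simps)
  qed
  have dle: "d \<le> US - UC"
  proof -
    have "(\<Sum>j<p. \<bar>\<beta> j\<bar>) - (\<Sum>j<p. \<bar>b j\<bar>)
       = (\<Sum>j\<in>S. \<bar>\<beta> j\<bar> - \<bar>b j\<bar>) + (\<Sum>j\<in>{..<p} - S. \<bar>\<beta> j\<bar> - \<bar>b j\<bar>)"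
      unfolding sum_subtractf[symmetric] using sum.subset_diff[OF S_fin(2), of "\<lambda>j. \<bar>\<beta> j\<bar> - \<bar>b j\<bar>"] by simp
    also have "(\<Sum>j\<in>S. \<bar>\<beta> j\<bar> - \<bar>b j\<bar>) \<le> US" unfolding US_def u_def by (intro sum_mono) auto
    also have "(\<Sum>j\<in>{..<p} - S. \<bar>\<beta> j\<bar> - \<bar>b j\<bar>) = - UC"
      unfolding UC_def u_def sum_negf[symmetric] by (intro sum.cong) (auto simp: S_def)
    finally show ?thesis unfolding d_def by simp
  qed
  have pyth: "Qh\<^sup>2 = N\<^sup>2 - 2 * cross + P\<^sup>2"
    unfolding Qh2 N2 P2 cross_def
    by (simp add: power2_diff sum.distrib sum_subtractf sum_distrib_left[symmetric] mult.assoc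
        add_divide_distrib diff_divide_distrib)
  have cs: "N\<^sup>2 - cross \<le> Qh * N"
  proof -
    have "(\<Sum>i<n. (\<epsilon> i - xu i) * \<epsilon> i) = (\<Sum>i<n. (\<epsilon> i)\<^sup>2) - (\<Sum>i<n. \<epsilon> i * xu i)"
      unfolding sum_subtractf[symmetric] by (rule sum.cong) (auto simp: power2_eq_square algebra_simps)
    then have "N\<^sup>2 - cross = (\<Sum>i<n. (\<epsilon> i - xu i) * \<epsilon> i) / real n"
      by (simp add: N2 cross_def diff_divide_distrib)
    then have "(N\<^sup>2 - cross)\<^sup>2 = ((\<Sum>i<n. (\<epsilon> i - xu i) * \<epsilon> i) / real n)\<^sup>2" by simp
    also have "\<dots> \<le> ((\<Sum>i<n. (\<epsilon> i - xu i)\<^sup>2) * (\<Sum>i<n. (\<epsilon> i)\<^sup>2)) / (real n)\<^sup>2"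
      unfolding power_divide by (intro divide_right_mono Cauchy_Schwarz_ineq_sum) auto
    also have "\<dots> = (Qh * N)\<^sup>2" unfolding power_mult_distrib Qh2 N2
      by (simp add: power2_eq_square[of "real n"])
    finally show ?thesis by (rule power2_le_imp_le) (simp add: Q0 N0)
  qed
  have N_low: "\<sigma> \<le> sqrt 2 * N" and N_up: "N \<le> sqrt 2 * \<sigma>"
  proof -
    have "\<sigma>\<^sup>2 \<le> (sqrt 2 * N)\<^sup>2" using low n0 by (simp add: power_mult_distrib N2 field_simps)
    then show "\<sigma> \<le> sqrt 2 * N" by (rule power2_le_imp_le) (use N0 in auto)
    have "N\<^sup>2 \<le> (sqrt 2 * \<sigma>)\<^sup>2" using up n0 by (simp add: power_mult_distrib N2 field_simps)
    then show "N \<le> sqrt 2 * \<sigma>" by (rule power2_le_imp_le) (use \<sigma> in auto)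
  qed
  \<comment> \<open>\<open>5\<close>, \<open>11\<close> and \<open>4.91\<close> are upper bounds for \<open>sqrt 2\<close> times \<open>3.47\<close>, \<open>7.75\<close> and \<open>3.47\<close>.
    The lower bound on \<open>\<gamma>\<close> enters through \<open>\<eta> \<le> 23/100\<close>, just below the value \<open>1/4\<close> that the
    cone constant \<open>8/3\<close> tolerates.\<close>
  define \<tau> where "\<tau> = 5 * g + 11 * h"
  define \<eta> where "\<eta> = 491/100 / \<gamma>"
  have \<tau>0: "0 \<le> \<tau>" using g0 h0 by (simp add: \<tau>_def)
  have \<eta>: "0 \<le> \<eta>" "\<eta> \<le> 23/100" using \<gamma>b by (simp_all add: \<eta>_def field_simps)
  have \<eta>lam: "\<eta> * (lam * U) = 491/100 * r * U" using \<gamma>b by (simp add: \<eta>_def lamr)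
  have cross_le: "cross \<le> N * (\<tau> * P + \<eta> * (lam * U))"
  proof (cases "P = 0")
    case True
    then have "xu i = 0" if "i < n" for i
      using P2 n0 that by (simp add: sum_nonneg_eq_0_iff)
    then have "cross = 0" by (simp add: cross_def)
    then show ?thesis unfolding \<eta>lam using N0 P0 \<tau>0 r0 U0 by simp
  next
    case False
    define V where "V = sqrt (real n) * P"
    have V: "0 < V" using False P0 n0 by (simp add: V_def)
    have V2: "V\<^sup>2 = (\<Sum>i<n. (xu i)\<^sup>2)" using n0 by (simp add: V_def power_mult_distrib P2)
    have bound: "(\<Sum>i<n. \<epsilon> i * xu i)
        \<le> \<sigma> * sqrt (2 * ell + 10 * real k * L) * sqrt (V\<^sup>2 + (sqrt (real n) * U)\<^sup>2 / real k)"
      if "s \<le> k" for k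
    proof -
      have "(\<Sum>i<n. \<epsilon> i * mat_vec p X u i) \<le> (\<sigma> * sqrt (2 * ell + 10 * real k * L)) *
         sqrt ((\<Sum>i<n. (mat_vec p X u i)\<^sup>2) + real n * (\<Sum>j<p. \<bar>u j\<bar>)\<^sup>2 / real k)"
      proof (rule noise_bound_from_counts[OF n])
        show "1 \<le> k" using s that by simp
        show "0 \<le> \<sigma> * sqrt (2 * ell + 10 * real k * L)" using \<sigma> ell Lp by simp
        show "(\<Sum>i<n. (X i j)\<^sup>2) \<le> real n" if "j < p" for j
        proof -
          have "emp_norm n (mat_vec p X (basis_vec j)) \<le> 1" using sre that by (simp add: SRE_def)
          then show ?thesis using n0 that by (simp add: emp_norm_def mat_vec_basis_vec field_simps)
        qed
      qed (use ev that in auto)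
      then show ?thesis by (simp add: xu_def V2 U_def power_mult_distrib)
    qed
    have "(\<Sum>i<n. \<epsilon> i * xu i) \<le> \<sigma> * ((347/100 * sqrt ell + 775/100 * sqrt (L * real s)) * V
         + 347/100 * sqrt L * (sqrt (real n) * U))"
      by (rule choose_sample_size[OF \<sigma> V _ _ ell s bound]) (use U0 Lp in auto)
    then have "cross \<le> \<sigma> * ((347/100 * sqrt ell + 775/100 * sqrt (L * real s)) * V
         + 347/100 * sqrt L * (sqrt (real n) * U)) / real n"
      unfolding cross_def using n0 by (intro divide_right_mono) auto
    also have "\<dots> = \<sigma> * ((347/100 * g + 775/100 * h) * P + 347/100 * r * U)"
    proof -
      have e: "sqrt ell = g * sqrt (real n)" "sqrt (L * real s) = h * sqrt (real n)" "sqrt L = r * sqrt (real n)"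
        using n0 by (simp_all add: g_def h_def r_def real_sqrt_mult[symmetric])
      have "\<sigma> * ((347/100 * (g * q) + 775/100 * (h * q)) * (q * P) + 347/100 * (r * q) * (q * U))
          = \<sigma> * ((347/100 * g + 775/100 * h) * P + 347/100 * r * U) * (q * q)" for q
        by (simp add: algebra_simps)
      then show ?thesis unfolding e V_def using n0 by (simp only: real_sqrt_mult_self) simp
    qed
    also have "\<dots> \<le> (sqrt 2 * N) * ((347/100 * g + 775/100 * h) * P + 347/100 * r * U)"
      using N_low g0 h0 P0 r0 U0 by (intro mult_right_mono) auto
    also have "\<dots> = N * ((sqrt 2 * 347/100 * g + sqrt 2 * 775/100 * h) * P + sqrt 2 * 347/100 * (r * U))"
      by (simp add: algebra_simps)
    also have "\<dots> \<le> N * ((5 * g + 11 * h) * P + 491/100 * (r * U))"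
    proof -
      have "sqrt (2::real) \<le> 14145/10000" by (rule real_le_lsqrt) (auto simp: power2_eq_square)
      then show ?thesis using N0 g0 h0 P0 r0 U0
        by (intro mult_left_mono add_mono mult_right_mono) auto
    qed
    finally show ?thesis unfolding \<tau>_def \<eta>lam by (simp add: mult.assoc)
  qed
  define k where "k = \<kappa> / sqrt (real s)"
  have k0: "0 < k" using \<kappa>0 s0 by (simp add: k_def)
  have kW: "k * W = \<kappa> * U2" using s0 by (simp add: k_def W_def)
  \<comment> \<open>The sparsity assumption, in the form \<open>\<gamma> h \<le> 3/16 \<kappa>\<close>.\<close>
  have lamk: "16 * lam \<le> 3 * k"
  proof -
    have "(16 * (\<gamma> * h))\<^sup>2 = 256 * \<gamma>\<^sup>2 * (real s / real n * L)"
      using n0 s0 Lp by (simp add: power_mult_distrib h_def)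
    also have "\<dots> \<le> 256 * \<gamma>\<^sup>2 * (9 * \<kappa>\<^sup>2 / (256 * \<gamma>\<^sup>2))"
      using small by (intro mult_left_mono) auto
    also have "\<dots> = (3 * \<kappa>)\<^sup>2" using \<gamma>b by (simp add: power_mult_distrib)
    finally have "16 * (\<gamma> * h) \<le> 3 * \<kappa>" by (rule power2_le_imp_le) (use \<kappa>0 in auto)
    then show ?thesis using s0 by (simp add: k_def lamr hr field_simps)
  qed
  have cone: "k * W \<le> P" if "3 * U \<le> 8 * W"
  proof -
    have "u \<in> sre_cone p s (5/3)"
      using that by (simp add: sre_cone_def lq_norm_1 lq_norm_2 U_def W_def U2_def)
    from sre_kappa_mult_le[OF this \<kappa>] show ?thesis unfolding kW P_emp
      by (simp add: lq_norm_2 U2_def)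
  qed
  have US: "0 \<le> US" "US \<le> W"
    using sum_abs_le_sqrt_card[OF S_fin, of u] by (simp_all add: US_def W_def U2_def sum_nonneg)
  have UC: "0 \<le> UC" by (simp add: UC_def sum_nonneg)
  have s2: "sqrt (2::real) \<le> 3/2" by (rule real_le_lsqrt) (auto simp: power2_eq_square)
  have s2': "sqrt (2::real) \<le> 10/7" by (rule real_le_lsqrt) (auto simp: power2_eq_square)
  have split: "(k * P \<le> 4 * N * lam \<and> k * W \<le> P \<and> 3 * U \<le> 8 * W)
       \<or> (P \<le> 70 * N * \<tau> \<and> lam * U \<le> 54 * \<tau> * P \<and> lam * W \<le> 20 * \<tau> * P)"
    by (rule basic_inequality_dichotomy[OF N0 Q0 P0 lam0 k0 lamk \<eta> \<tau>0 basic dle U_split UC US cross_le pyth cs cone])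
  have goal_norms: "lq_norm p 1 u = U" "sqrt (real s) * lq_norm p 2 u = W"
    by (simp_all add: lq_norm_1 lq_norm_2 U_def W_def U2_def)
  show ?thesis using split
  proof
    assume I: "k * P \<le> 4 * N * lam \<and> k * W \<le> P \<and> 3 * U \<le> 8 * W"
    have "\<kappa> * P \<le> 4 * N * (\<gamma> * h)"
      using I s0 by (simp add: k_def lamr hr field_simps)
    also have "\<dots> \<le> 4 * (3/2 * \<sigma>) * (\<gamma> * h)"
      using N_up s2 \<sigma> \<gamma>b h0 mult_right_mono[OF s2 \<sigma>] by (intro mult_right_mono mult_left_mono) auto
    finally have \<kappa>P: "\<kappa> * P \<le> 6 * \<sigma> * \<gamma> * h" by simp
    have "\<kappa> * (\<kappa> * P) \<le> 1 * (\<kappa> * P)" using \<kappa>1 \<kappa>0 P0 by (intro mult_right_mono) auto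
    then have "\<kappa>\<^sup>2 * P \<le> 6 * \<sigma> * \<gamma> * h" using \<kappa>P by (simp add: power2_eq_square mult.assoc)
    then have PI: "P \<le> \<sigma> * (6 * \<gamma> / \<kappa>\<^sup>2 * h)" using \<kappa>0 by (simp add: field_simps)
    define R where "R = \<sigma> * (16 * \<gamma> / \<kappa>\<^sup>2 * r)"
    have "\<kappa> * (\<kappa> * W) = sqrt (real s) * (\<kappa> * (k * W))" using s0 by (simp add: k_def)
    also have "\<dots> \<le> sqrt (real s) * (\<kappa> * P)" using I \<kappa>0 by (intro mult_left_mono) auto
    also have "\<dots> \<le> sqrt (real s) * (6 * \<sigma> * \<gamma> * h)" using \<kappa>P by (intro mult_left_mono) auto
    also have "\<dots> = 6 * \<sigma> * \<gamma> * (real s * r)" using s0 by (simp add: hr)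
    finally have "\<kappa>\<^sup>2 * W \<le> 6 * \<sigma> * \<gamma> * (real s * r)" by (simp add: power2_eq_square mult.assoc)
    then have W6: "W \<le> 6/16 * (real s * R)" using \<kappa>0 by (simp add: R_def field_simps)
    have R0: "0 \<le> R" using \<sigma> \<gamma>b r0 by (simp add: R_def)
    then have "0 \<le> real s * R" by simp
    then have "W \<le> real s * R" "U \<le> real s * R" using W6 I by linarith+
    then show ?thesis unfolding goal_norms P_emp using PI R0 unfolding R_def by blast
  next
    assume II: "P \<le> 70 * N * \<tau> \<and> lam * U \<le> 54 * \<tau> * P \<and> lam * W \<le> 20 * \<tau> * P"
    have "P \<le> 70 * (10/7 * \<sigma>) * \<tau>"
    proof -
      have "N \<le> 10/7 * \<sigma>" using N_up mult_right_mono[OF s2' \<sigma>] by simp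
      then have "70 * N * \<tau> \<le> 70 * (10/7 * \<sigma>) * \<tau>" using \<tau>0 by (intro mult_right_mono mult_left_mono) auto
      then show ?thesis using II by simp
    qed
    then have P100: "P \<le> 100 * \<sigma> * \<tau>" by simp
    have "\<tau> * P \<le> \<tau> * (100 * \<sigma> * \<tau>)" using P100 \<tau>0 by (rule mult_left_mono)
    then have \<tau>P: "\<tau> * P \<le> 100 * \<sigma> * \<tau>\<^sup>2" by (simp add: power2_eq_square algebra_simps)
    have "\<tau>\<^sup>2 \<le> 50 * g\<^sup>2 + 242 * h\<^sup>2"
    proof -
      have "50 * g\<^sup>2 + 242 * h\<^sup>2 - \<tau>\<^sup>2 = (5 * g - 11 * h)\<^sup>2"
        by (simp add: \<tau>_def power2_eq_square algebra_simps)
      then show ?thesis using zero_le_power2[of "5 * g - 11 * h"] by linarith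
    qed
    then have "100 * \<sigma> * \<tau>\<^sup>2 \<le> 100 * \<sigma> * (50 * g\<^sup>2 + 242 * h\<^sup>2)" using \<sigma> by (intro mult_left_mono) auto
    then have \<tau>P2: "\<tau> * P \<le> 100 * \<sigma> * (50 * g\<^sup>2 + 242 * h\<^sup>2)" using \<tau>P by simp
    \<comment> \<open>\<open>1306800 = 54 * 100 * 242\<close> and \<open>270000 = 54 * 100 * 50\<close>.\<close>
    define R where "R = \<sigma> * (1306800 * r + 270000 * (w / real s))"
    have g2: "g\<^sup>2 = w * r"
    proof -
      have "w * r = sqrt (ell\<^sup>2 / (real n * L) * (1 / real n * L))"
        unfolding w_def r_def by (rule real_sqrt_mult[symmetric])
      also have "ell\<^sup>2 / (real n * L) * (1 / real n * L) = (ell / real n)\<^sup>2"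
        using Lp n0 by (simp add: power2_eq_square)
      finally show ?thesis using ell n0 by (simp add: g_def)
    qed
    have h2: "h\<^sup>2 = real s * r * r" using s0 by (simp add: hr power_mult_distrib power2_eq_square)
    have \<tau>PR: "54 * (\<tau> * P) \<le> r * (real s * R)"
    proof -
      have "r * (real s * R) = 5400 * \<sigma> * (50 * g\<^sup>2 + 242 * h\<^sup>2)"
        unfolding g2 h2 R_def using s0 by (simp add: field_simps)
      then show ?thesis using \<tau>P2 by linarith
    qed
    have w0: "0 \<le> w" using ell n0 Lp by (simp add: w_def)
    have R0: "0 \<le> R" using \<sigma> r0 w0 by (simp add: R_def)
    have tP: "0 \<le> \<tau> * P" using \<tau>0 P0 by simp
    have red: "x \<le> real s * R" if "lam * x \<le> 54 * (\<tau> * P)" "0 \<le> x" for x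
    proof -
      have "1 * r * x \<le> \<gamma> * r * x" using \<gamma>b r0 that by (intro mult_right_mono) auto
      then have "r * x \<le> r * (real s * R)" using that \<tau>PR by (simp add: lamr)
      then show ?thesis using r0 by simp
    qed
    have "U \<le> real s * R" "W \<le> real s * R"
      using II tP U0 W0 by (auto intro!: red)
    moreover have "P \<le> \<sigma> * (1100 * h + 500 * g)" using P100 by (simp add: \<tau>_def algebra_simps)
    ultimately show ?thesis unfolding goal_norms P_emp using R0 unfolding R_def by blast
  qed
qed

section \<open>The good event under the regression law\<close>

lemma gaussian_noise_eq:
  "gaussian_noise n \<sigma> = distr (std_gaussian n) (\<Pi>\<^sub>M i\<in>{..<n}. borel) (compose {..<n} (\<lambda>z. \<sigma> * z))"
proof -
  have d: "distr std_normal_distribution borel (\<lambda>z. \<sigma> * z)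
      = distr std_normal_distribution std_normal_distribution (\<lambda>z. \<sigma> * z)"
    by (rule distr_cong) auto
  have "gaussian_noise n \<sigma> = distr (std_gaussian n) (std_gaussian n) (compose {..<n} (\<lambda>z. \<sigma> * z))"
    unfolding gaussian_noise_def d
    by (rule distr_PiM_finite_prob_space'[symmetric]) (auto intro: prob_space_std_normal)
  also have "\<dots> = distr (std_gaussian n) (\<Pi>\<^sub>M i\<in>{..<n}. borel) (compose {..<n} (\<lambda>z. \<sigma> * z))"
    by (rule distr_cong) (auto simp: measurable_std_gaussian)
  finally show ?thesis .
qed

lemma regression_law_eq:
  "regression_law n p X \<beta> \<sigma> = distr (std_gaussian n) (\<Pi>\<^sub>M i\<in>{..<n}. borel)
     (\<lambda>\<xi>. \<lambda>i\<in>{..<n}. mat_vec p X \<beta> i + \<sigma> * \<xi> i)"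
proof -
  have m1: "compose {..<n} (\<lambda>z. \<sigma> * z) \<in> std_gaussian n \<rightarrow>\<^sub>M (\<Pi>\<^sub>M i\<in>{..<n}. borel)"
    unfolding compose_def by measurable
  have m2: "(\<lambda>\<epsilon>. \<lambda>i\<in>{..<n}. mat_vec p X \<beta> i + \<epsilon> i)
      \<in> (\<Pi>\<^sub>M i\<in>{..<n}. borel) \<rightarrow>\<^sub>M (\<Pi>\<^sub>M i\<in>{..<n}. borel)"
    by measurable
  show ?thesis
    unfolding regression_law_def gaussian_noise_eq distr_distr[OF m2 m1]
    by (rule distr_cong) (auto simp: compose_def restrict_def fun_eq_iff)
qed

text \<open>
  The event is phrased in terms of the observable \<open>y\<close> without dividing by \<open>\<sigma>\<close>, so it remains
  meaningful for \<open>\<sigma> = 0\<close>: its preimage contains every \<open>\<xi>\<close> that satisfies the normalised bounds.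
\<close>

lemma good_event_probability:
  fixes X :: "nat \<Rightarrow> nat \<Rightarrow> real" and \<beta> :: "nat \<Rightarrow> real" and n p s :: nat and \<delta>0 \<sigma> :: real
  assumes s: "1 \<le> s" and sp: "s \<le> p" and d: "0 < \<delta>0" "\<delta>0 \<le> 1" and \<sigma>: "0 \<le> \<sigma>"
  defines "good \<equiv> {y \<in> space (\<Pi>\<^sub>M i\<in>{..<n}. borel).
      \<sigma>\<^sup>2 * (real n / 2) \<le> (\<Sum>i<n. (y i - mat_vec p X \<beta> i)\<^sup>2) \<and>
      (\<Sum>i<n. (y i - mat_vec p X \<beta> i)\<^sup>2) \<le> \<sigma>\<^sup>2 * (2 * real n) \<and>
      (\<forall>l. s \<le> sum_list l \<longrightarrow> length l = 2 * p \<longrightarrow>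
        (\<Sum>i<n. (y i - mat_vec p X \<beta> i) * column_comb p X l i)
          \<le> \<sigma> * sqrt (2 * ln (1 / \<delta>0) + 10 * real (sum_list l) * ln (2 * real p / real s))
               * sqrt (\<Sum>i<n. (column_comb p X l i)\<^sup>2))}"
  shows "good \<in> sets (regression_law n p X \<beta> \<sigma>)"
    and "1 - \<delta>0 - 2 * exp (- real n / 24) \<le> measure (regression_law n p X \<beta> \<sigma>) good"
proof -
  interpret P: prob_space "std_gaussian n" by (rule prob_space_std_gaussian)
  define shift where "shift = (\<lambda>\<xi>. \<lambda>i\<in>{..<n}. mat_vec p X \<beta> i + \<sigma> * \<xi> i)"
  have shift_meas: "shift \<in> std_gaussian n \<rightarrow>\<^sub>M (\<Pi>\<^sub>M i\<in>{..<n}. borel)"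
    unfolding shift_def by measurable
  have good_sets: "good \<in> sets (\<Pi>\<^sub>M i\<in>{..<n}. borel)"
  proof -
    let ?M = "\<Pi>\<^sub>M i\<in>{..<n}. borel :: real measure"
    have half: "{y \<in> space ?M. (\<Sum>i<n. (y i - m i) * v i) \<le> K} \<in> sets ?M" for m v and K :: real
      by measurable
    have norms: "{y \<in> space ?M. K \<le> (\<Sum>i<n. (y i - m i)\<^sup>2)} \<in> sets ?M"
      "{y \<in> space ?M. (\<Sum>i<n. (y i - m i)\<^sup>2) \<le> K} \<in> sets ?M" for m and K :: real
      by measurable
    show ?thesis
      unfolding good_def
      by (intro sets.sets_Collect_conj norms sets.sets_Collect_countable_All
          sets.sets_Collect_imp sets.sets_Collect_const half)
  qed
  then show "good \<in> sets (regression_law n p X \<beta> \<sigma>)" by (simp add: regression_law_eq)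
  define B1 where "B1 = {\<xi> \<in> space (std_gaussian n). (\<Sum>r<n. (\<xi> r)\<^sup>2) < real n / 2}"
  define B2 where "B2 = {\<xi> \<in> space (std_gaussian n). 2 * real n < (\<Sum>r<n. (\<xi> r)\<^sup>2)}"
  define B3 where "B3 = {\<xi> \<in> space (std_gaussian n). \<exists>k\<ge>s. \<exists>l. length l = 2 * p \<and> sum_list l = k \<and>
     sqrt (2 * ln (1 / \<delta>0) + 10 * real k * ln (2 * real p / real s))
        * sqrt (\<Sum>r<n. (column_comb p X l r)\<^sup>2) < (\<Sum>r<n. \<xi> r * column_comb p X l r)}"
  have B1s: "B1 \<in> sets (std_gaussian n)" and B2s: "B2 \<in> sets (std_gaussian n)"
    unfolding B1_def B2_def by measurable
  have B3s: "B3 \<in> sets (std_gaussian n)"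
    unfolding B3_def by (rule uniform_count_event(1)[OF s sp d])
  note Bs = B1s B2s B3s
  have m3: "measure (std_gaussian n) B3 \<le> \<delta>0"
    unfolding B3_def by (rule uniform_count_event(2)[OF s sp d])
  have "measure (std_gaussian n) (B1 \<union> B2 \<union> B3)
      \<le> measure (std_gaussian n) B1 + measure (std_gaussian n) B2 + measure (std_gaussian n) B3"
    using Bs measure_Un_le[of "B1 \<union> B2" "std_gaussian n" B3] measure_Un_le[of B1 "std_gaussian n" B2] by simp
  also have "\<dots> \<le> exp (- real n / 24) + exp (- real n / 24) + \<delta>0"
    using chi_square_lower_tail[of n] chi_square_upper_tail[of n] m3
    unfolding B1_def[symmetric] B2_def[symmetric] by (intro add_mono)
  finally have "1 - \<delta>0 - 2 * exp (- real n / 24)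
      \<le> measure (std_gaussian n) (space (std_gaussian n) - (B1 \<union> B2 \<union> B3))"
    using Bs by (subst P.prob_compl) auto
  also have "\<dots> \<le> measure (std_gaussian n) (shift -` good \<inter> space (std_gaussian n))"
  proof (rule P.finite_measure_mono)
    show "shift -` good \<inter> space (std_gaussian n) \<in> sets (std_gaussian n)"
      using shift_meas good_sets by (rule measurable_sets)
    show "space (std_gaussian n) - (B1 \<union> B2 \<union> B3) \<subseteq> shift -` good \<inter> space (std_gaussian n)"
    proof
      fix \<xi> assume \<xi>: "\<xi> \<in> space (std_gaussian n) - (B1 \<union> B2 \<union> B3)"
      have e: "shift \<xi> i - mat_vec p X \<beta> i = \<sigma> * \<xi> i" if "i < n" for i
        using that by (simp add: shift_def)
      have sq: "(\<Sum>i<n. (shift \<xi> i - mat_vec p X \<beta> i)\<^sup>2) = \<sigma>\<^sup>2 * (\<Sum>i<n. (\<xi> i)\<^sup>2)"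
        by (simp add: e power_mult_distrib sum_distrib_left)
      have lin: "(\<Sum>i<n. (shift \<xi> i - mat_vec p X \<beta> i) * v i) = \<sigma> * (\<Sum>i<n. \<xi> i * v i)" for v
        by (simp add: e sum_distrib_left mult.assoc)
      have "(\<Sum>r<n. \<xi> r * column_comb p X l r)
          \<le> sqrt (2 * ln (1 / \<delta>0) + 10 * real (sum_list l) * ln (2 * real p / real s))
               * sqrt (\<Sum>r<n. (column_comb p X l r)\<^sup>2)"
        if "s \<le> sum_list l" "length l = 2 * p" for l
        using \<xi> that unfolding B3_def by (auto simp: not_less)
      moreover have "shift \<xi> \<in> space (\<Pi>\<^sub>M i\<in>{..<n}. borel)"
        using \<xi> shift_meas by (auto dest: measurable_space)
      moreover have "real n / 2 \<le> (\<Sum>i<n. (\<xi> i)\<^sup>2)" "(\<Sum>i<n. (\<xi> i)\<^sup>2) \<le> 2 * real n"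
        using \<xi> unfolding B1_def B2_def by auto
      ultimately show "\<xi> \<in> shift -` good \<inter> space (std_gaussian n)"
        using \<xi> \<sigma> unfolding good_def
        by (auto simp only: sq lin vimage_def mem_Collect_eq Int_iff mult.assoc intro!: mult_left_mono) auto
    qed
  qed
  also have "\<dots> = measure (regression_law n p X \<beta> \<sigma>) good"
    unfolding regression_law_eq shift_def[symmetric]
    by (rule measure_distr[OF shift_meas good_sets, symmetric])
  finally show "1 - \<delta>0 - 2 * exp (- real n / 24) \<le> measure (regression_law n p X \<beta> \<sigma>) good" .
qed

section \<open>Error bounds for the estimator\<close>

(* The prediction bound is stated with log(2p/s) for every s, and in addition with log(p/s) when
   2 s <= p. With log(p/s) and no restriction on s it is false: at s = p that logarithm is 0. *)
theorem theorem3p1: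
  fixes \<gamma> :: real
  assumes "\<gamma> \<ge> 16 + 4 * sqrt 2"
  shows "\<exists>C1 C2 C3 C4 :: real. C1 > 0 \<and> C2 > 0 \<and> C3 > 0 \<and> C4 > 0 \<and>
    (\<forall>(n::nat) (p::nat) (s::nat) (X :: nat \<Rightarrow> nat \<Rightarrow> real) (\<sigma>::real) (\<kappa>::real) (lam::real)
      (bhat :: (nat \<Rightarrow> real) \<Rightarrow> (nat \<Rightarrow> real)).
      n \<ge> 1 \<longrightarrow> 1 \<le> s \<longrightarrow> s \<le> p \<longrightarrow> \<sigma> \<ge> 0 \<longrightarrow>
      SRE n p X s (5/3) \<longrightarrow> \<kappa> = sre_kappa n p X s (5/3) \<longrightarrow>
      lam = \<gamma> * sqrt (1 / real n * ln (2 * real p / real s)) \<longrightarrow>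
      real s / real n * ln (2 * real p / real s) \<le> 9 * \<kappa>\<^sup>2 / (256 * \<gamma>\<^sup>2) \<longrightarrow>
      (\<forall>y. bhat y \<in> sqrt_lasso n p X lam y) \<longrightarrow>
      (\<forall>(\<delta>0::real) (\<beta> :: nat \<Rightarrow> real).
        \<delta>0 \<ge> exp (- real n / (4 * \<gamma>\<^sup>2)) \<longrightarrow> l0_norm p \<beta> \<le> s \<longrightarrow>
        prob_at_least (regression_law n p X \<beta> \<sigma>)
          {y \<in> space (regression_law n p X \<beta> \<sigma>).
            emp_norm n (mat_vec p X (\<lambda>j. bhat y j - \<beta> j))
              \<le> \<sigma> * max (C1 / \<kappa>\<^sup>2 * sqrt (real s / real n * ln (2 * real p / real s)))
                       (C2 * sqrt (ln (1 / \<delta>0) / real n)) \<and>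
            (2 * s \<le> p \<longrightarrow>
              emp_norm n (mat_vec p X (\<lambda>j. bhat y j - \<beta> j))
                \<le> \<sigma> * max (C1 / \<kappa>\<^sup>2 * sqrt (real s / real n * ln (real p / real s)))
                         (C2 * sqrt (ln (1 / \<delta>0) / real n))) \<and>
            (\<forall>q::real. 1 \<le> q \<and> q \<le> 2 \<longrightarrow>
              lq_norm p q (\<lambda>j. bhat y j - \<beta> j)
                \<le> \<sigma> * max (C3 / \<kappa>\<^sup>2 * real s powr (1 / q)
                             * sqrt (1 / real n * ln (2 * real p / real s)))
                         (C4 * real s powr (1 / q - 1)
                             * sqrt ((ln (1 / \<delta>0))\<^sup>2 / (real n * ln (2 * real p / real s)))))}
          (1 - \<delta>0 - (1 + (exp 1)\<^sup>2) * exp (- real n / 24))))"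
proof -
  \<comment> \<open>\<open>C1\<close> carries the factor \<open>sqrt 2\<close> needed to replace \<open>ln (2 p / s)\<close> by \<open>ln (p / s)\<close>. In all
    constants, a sum of two terms is bounded by twice the larger one.\<close>
  define C1 where "C1 = sqrt 2 * (6 * \<gamma> + 2200)"
  define C2 where "C2 = (1000::real)"
  define C3 where "C3 = 32 * \<gamma> + 5227200"
  define C4 where "C4 = (1080000::real)"
  have \<gamma>0: "0 \<le> \<gamma>" using assms by (rule order_trans[rotated]) simp
  have pos: "0 < C1" "0 < C2" "0 < C3" "0 < C4"
    using \<gamma>0 by (simp_all add: C1_def C2_def C3_def C4_def add_nonneg_pos)
  have main: "prob_at_least (regression_law n p X \<beta> \<sigma>)
          {y \<in> space (regression_law n p X \<beta> \<sigma>).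
            emp_norm n (mat_vec p X (\<lambda>j. bhat y j - \<beta> j))
              \<le> \<sigma> * max (C1 / \<kappa>\<^sup>2 * sqrt (real s / real n * ln (2 * real p / real s)))
                       (C2 * sqrt (ln (1 / \<delta>0) / real n)) \<and>
            (2 * s \<le> p \<longrightarrow>
              emp_norm n (mat_vec p X (\<lambda>j. bhat y j - \<beta> j))
                \<le> \<sigma> * max (C1 / \<kappa>\<^sup>2 * sqrt (real s / real n * ln (real p / real s)))
                         (C2 * sqrt (ln (1 / \<delta>0) / real n))) \<and>
            (\<forall>q::real. 1 \<le> q \<and> q \<le> 2 \<longrightarrow>
              lq_norm p q (\<lambda>j. bhat y j - \<beta> j)
                \<le> \<sigma> * max (C3 / \<kappa>\<^sup>2 * real s powr (1 / q)
                             * sqrt (1 / real n * ln (2 * real p / real s)))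
                         (C4 * real s powr (1 / q - 1)
                             * sqrt ((ln (1 / \<delta>0))\<^sup>2 / (real n * ln (2 * real p / real s)))))}
          (1 - \<delta>0 - (1 + (exp 1)\<^sup>2) * exp (- real n / 24))" (is "prob_at_least ?M ?E ?r")
    if n: "1 \<le> n" and s: "1 \<le> s" and sp: "s \<le> p" and \<sigma>: "0 \<le> \<sigma>" and sre: "SRE n p X s (5/3)"
      and \<kappa>: "\<kappa> = sre_kappa n p X s (5/3)"
      and lam: "lam = \<gamma> * sqrt (1 / real n * ln (2 * real p / real s))"
      and small: "real s / real n * ln (2 * real p / real s) \<le> 9 * \<kappa>\<^sup>2 / (256 * \<gamma>\<^sup>2)"
      and bhat: "\<forall>y. bhat y \<in> sqrt_lasso n p X lam y"
      and \<delta>0: "\<delta>0 \<ge> exp (- real n / (4 * \<gamma>\<^sup>2))" and \<beta>: "l0_norm p \<beta> \<le> s"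
    for n p s :: nat and X and \<sigma> \<kappa> lam \<delta>0 :: real and bhat and \<beta> :: "nat \<Rightarrow> real"
  proof (cases "\<delta>0 < 1")
    case False
    \<comment> \<open>The required probability is not positive, so the empty event suffices.\<close>
    have "0 \<le> (1 + (exp 1)\<^sup>2) * exp (- real n / 24)" by (intro mult_nonneg_nonneg) auto
    then have "?r \<le> 0" using False by linarith
    then have "?r \<le> measure ?M {}" by simp
    then show ?thesis unfolding prob_at_least_def by (intro bexI[of _ "{}"]) auto
  next
    case True
    define L where "L = ln (2 * real p / real s)"
    define ell where "ell = ln (1 / \<delta>0)"
    have d: "0 < \<delta>0" "\<delta>0 \<le> 1" using less_le_trans[OF exp_gt_zero \<delta>0] True by simp_all
    have ell: "0 \<le> ell" using d by (simp add: ell_def)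
    have s0: "0 < real s" and n0: "0 < real n" using s n by simp_all
    have "2 \<le> 2 * real p / real s" using s sp by (simp add: field_simps)
    then have L0: "0 < L" unfolding L_def by (intro ln_gt_zero) auto
    have \<kappa>0: "0 < \<kappa>" using sre \<kappa> by (simp add: SRE_def)
    have \<kappa>1: "\<kappa> \<le> 1" using sre_kappa_le_1[OF sre] s sp \<kappa> by simp
    have \<kappa>2: "1 \<le> 1 / \<kappa>\<^sup>2" using \<kappa>0 \<kappa>1 by (simp add: power_le_one)
    define h where "h = sqrt (real s / real n * L)"
    define g where "g = sqrt (ell / real n)"
    define r where "r = sqrt (1 / real n * L)"
    define w where "w = sqrt (ell\<^sup>2 / (real n * L))"
    have nn: "0 \<le> h" "0 \<le> g" "0 \<le> r" "0 \<le> w"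
      using L0 ell n0 by (simp_all add: h_def g_def r_def w_def)
    define A where "A = {y \<in> space (\<Pi>\<^sub>M i\<in>{..<n}. borel).
      \<sigma>\<^sup>2 * (real n / 2) \<le> (\<Sum>i<n. (y i - mat_vec p X \<beta> i)\<^sup>2) \<and>
      (\<Sum>i<n. (y i - mat_vec p X \<beta> i)\<^sup>2) \<le> \<sigma>\<^sup>2 * (2 * real n) \<and>
      (\<forall>l. s \<le> sum_list l \<longrightarrow> length l = 2 * p \<longrightarrow>
        (\<Sum>i<n. (y i - mat_vec p X \<beta> i) * column_comb p X l i)
          \<le> \<sigma> * sqrt (2 * ln (1 / \<delta>0) + 10 * real (sum_list l) * ln (2 * real p / real s))
               * sqrt (\<Sum>i<n. (column_comb p X l i)\<^sup>2))}"
    have A_sets: "A \<in> sets ?M" unfolding A_def by (rule good_event_probability(1)[OF s sp d \<sigma>])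
    have "1 - \<delta>0 - 2 * exp (- real n / 24) \<le> measure ?M A"
      unfolding A_def by (rule good_event_probability(2)[OF s sp d \<sigma>])
    moreover have "2 * exp (- real n / 24) \<le> (1 + (exp 1)\<^sup>2) * exp (- real n / 24)"
    proof -
      have "1 \<le> (exp (1::real))\<^sup>2" by (intro one_le_power) simp
      then show ?thesis by (intro mult_right_mono) auto
    qed
    ultimately have A_prob: "?r \<le> measure ?M A" by linarith
    have "A \<subseteq> ?E"
    proof
      fix y assume y: "y \<in> A"
      define u where "u j = bhat y j - \<beta> j" for j
      define P where "P = emp_norm n (mat_vec p X u)"
      have "\<exists>R. 0 \<le> R \<and> lq_norm p 1 u \<le> real s * R \<and> sqrt (real s) * lq_norm p 2 u \<le> real s * R
        \<and> (emp_norm n (mat_vec p X u) \<le> \<sigma> * (6 * \<gamma> / \<kappa>\<^sup>2 * h) \<and> R \<le> \<sigma> * (16 * \<gamma> / \<kappa>\<^sup>2 * r)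
         \<or> emp_norm n (mat_vec p X u) \<le> \<sigma> * (1100 * h + 500 * g)
          \<and> R \<le> \<sigma> * (1306800 * r + 270000 * (w / real s)))"
        unfolding u_def h_def g_def r_def w_def
      proof (rule sqrt_lasso_deterministic[where \<epsilon> = "\<lambda>i. y i - mat_vec p X \<beta> i"
            and y = y and lam = lam, OF assms n s sp \<sigma> sre \<kappa> L_def])
        show "lam = \<gamma> * sqrt (1 / real n * L)" by (simp add: lam L_def)
        show "real s / real n * L \<le> 9 * \<kappa>\<^sup>2 / (256 * \<gamma>\<^sup>2)" using small by (simp add: L_def)
        show "bhat y \<in> sqrt_lasso n p X lam y" using bhat by blast
      qed (use \<beta> ell y in \<open>auto simp: A_def ell_def L_def\<close>)
      then obtain R where R: "0 \<le> R" "lq_norm p 1 u \<le> real s * R" "sqrt (real s) * lq_norm p 2 u \<le> real s * R"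
        and alt: "P \<le> \<sigma> * (6 * \<gamma> / \<kappa>\<^sup>2 * h) \<and> R \<le> \<sigma> * (16 * \<gamma> / \<kappa>\<^sup>2 * r)
         \<or> P \<le> \<sigma> * (1100 * h + 500 * g) \<and> R \<le> \<sigma> * (1306800 * r + 270000 * (w / real s))"
        unfolding P_def by blast
      have pred: "P \<le> \<sigma> * max ((6 * \<gamma> + 2200) / \<kappa>\<^sup>2 * h) (1000 * g)"
      proof -
        have "6 * \<gamma> / \<kappa>\<^sup>2 * h \<le> (6 * \<gamma> + 2200) / \<kappa>\<^sup>2 * h"
          using nn by (intro mult_right_mono divide_right_mono) auto
        moreover have "2200 * h \<le> (6 * \<gamma> + 2200) / \<kappa>\<^sup>2 * h"
        proof -
          have "2200 * 1 \<le> (6 * \<gamma> + 2200) * (1 / \<kappa>\<^sup>2)" using \<kappa>2 \<gamma>0 by (intro mult_mono) auto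
          then show ?thesis using nn by (intro mult_right_mono) auto
        qed
        ultimately have "6 * \<gamma> / \<kappa>\<^sup>2 * h \<le> max ((6 * \<gamma> + 2200) / \<kappa>\<^sup>2 * h) (1000 * g)"
          "1100 * h + 500 * g \<le> max ((6 * \<gamma> + 2200) / \<kappa>\<^sup>2 * h) (1000 * g)" by linarith+
        then show ?thesis using alt \<sigma> by (meson mult_left_mono order_trans)
      qed
      have c1: "P \<le> \<sigma> * max (C1 / \<kappa>\<^sup>2 * h) (C2 * g)"
      proof -
        have "1 * (6 * \<gamma> + 2200) \<le> C1" unfolding C1_def using \<gamma>0 by (intro mult_right_mono) auto
        then have "(6 * \<gamma> + 2200) / \<kappa>\<^sup>2 * h \<le> C1 / \<kappa>\<^sup>2 * h"
          using nn by (intro mult_right_mono divide_right_mono) auto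
        then have "max ((6 * \<gamma> + 2200) / \<kappa>\<^sup>2 * h) (1000 * g) \<le> max (C1 / \<kappa>\<^sup>2 * h) (C2 * g)"
          unfolding C2_def by (intro max.mono) auto
        then show ?thesis using pred \<sigma> by (meson mult_left_mono order_trans)
      qed
      have c2: "P \<le> \<sigma> * max (C1 / \<kappa>\<^sup>2 * sqrt (real s / real n * ln (real p / real s))) (C2 * g)" if sp2: "2 * s \<le> p"
      proof -
        have x2: "2 \<le> real p / real s" using s0 sp2 by (simp add: field_simps)
        \<comment> \<open>Since \<open>p / s \<ge> 2\<close>, the extra \<open>ln 2\<close> is at most \<open>ln (p / s)\<close>.\<close>
        have "L = ln (2 * (real p / real s))" by (simp add: L_def)
        also have "\<dots> = ln 2 + ln (real p / real s)" using x2 by (intro ln_mult_pos) auto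
        also have "\<dots> \<le> 2 * ln (real p / real s)" using x2 by simp
        finally have "real s / real n * L \<le> real s / real n * (2 * ln (real p / real s))"
          by (intro mult_left_mono) auto
        then have "h \<le> sqrt (2 * (real s / real n * ln (real p / real s)))"
          unfolding h_def by (intro real_sqrt_le_mono) (simp add: mult.left_commute)
        also have "\<dots> = sqrt 2 * sqrt (real s / real n * ln (real p / real s))"
          by (rule real_sqrt_mult)
        finally have "(6 * \<gamma> + 2200) / \<kappa>\<^sup>2 * h
            \<le> (6 * \<gamma> + 2200) / \<kappa>\<^sup>2 * (sqrt 2 * sqrt (real s / real n * ln (real p / real s)))"
          using \<gamma>0 by (intro mult_left_mono) auto
        also have "\<dots> = C1 / \<kappa>\<^sup>2 * sqrt (real s / real n * ln (real p / real s))"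
          by (simp add: C1_def)
        finally have "max ((6 * \<gamma> + 2200) / \<kappa>\<^sup>2 * h) (1000 * g)
            \<le> max (C1 / \<kappa>\<^sup>2 * sqrt (real s / real n * ln (real p / real s))) (C2 * g)"
          unfolding C2_def by (intro max.mono) auto
        then show ?thesis using pred \<sigma> by (meson mult_left_mono order_trans)
      qed
      have c3: "lq_norm p q u \<le> \<sigma> * max (C3 / \<kappa>\<^sup>2 * real s powr (1 / q) * r) (C4 * real s powr (1 / q - 1) * w)"
        if q: "1 \<le> q" "q \<le> 2" for q
      proof -
        have "(\<Sum>j<p. (u j)\<^sup>2) \<le> real s * R\<^sup>2"
        proof -
          have "(sqrt (real s) * lq_norm p 2 u)\<^sup>2 \<le> (real s * R)\<^sup>2"
            using R(3) by (intro power_mono) (auto simp: lq_norm_2 sum_nonneg)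
          moreover have "(sqrt (real s) * lq_norm p 2 u)\<^sup>2 = real s * (\<Sum>j<p. (u j)\<^sup>2)"
            by (simp add: power_mult_distrib lq_norm_2 sum_nonneg)
          moreover have "(real s * R)\<^sup>2 = real s * (real s * R\<^sup>2)" by (simp add: power2_eq_square)
          ultimately show ?thesis using s0 by simp
        qed
        then have "lq_norm p q u \<le> 2 * real s powr (1 / q) * R"
          using R(2) by (intro lq_norm_interpolation q R(1)) (auto simp: lq_norm_1)
        also have "\<dots> \<le> 2 * real s powr (1 / q) * (\<sigma> * (1/2 * max (C3 / \<kappa>\<^sup>2 * r) (C4 * (w / real s))))"
        proof (rule mult_left_mono)
          have "32 * \<gamma> / \<kappa>\<^sup>2 * r \<le> C3 / \<kappa>\<^sup>2 * r" unfolding C3_def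
            using nn by (intro mult_right_mono divide_right_mono) auto
          moreover have "5227200 * r \<le> C3 / \<kappa>\<^sup>2 * r"
          proof -
            have "5227200 * 1 \<le> C3 * (1 / \<kappa>\<^sup>2)" unfolding C3_def using \<kappa>2 \<gamma>0 by (intro mult_mono) auto
            then show ?thesis using nn by (intro mult_right_mono) auto
          qed
          moreover have "32 * \<gamma> / \<kappa>\<^sup>2 * r = 2 * (16 * \<gamma> / \<kappa>\<^sup>2 * r)" by simp
          moreover have "C4 * (w / real s) = 1080000 * (w / real s)" by (simp add: C4_def)
          ultimately have "16 * \<gamma> / \<kappa>\<^sup>2 * r \<le> 1/2 * max (C3 / \<kappa>\<^sup>2 * r) (C4 * (w / real s))"
            "1306800 * r + 270000 * (w / real s) \<le> 1/2 * max (C3 / \<kappa>\<^sup>2 * r) (C4 * (w / real s))"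
            by linarith+
          then show "R \<le> \<sigma> * (1/2 * max (C3 / \<kappa>\<^sup>2 * r) (C4 * (w / real s)))"
            using alt \<sigma> by (meson mult_left_mono order_trans)
        qed simp
        also have "\<dots> = \<sigma> * (real s powr (1 / q) * max (C3 / \<kappa>\<^sup>2 * r) (C4 * (w / real s)))" by simp
        also have "real s powr (1 / q) * max (C3 / \<kappa>\<^sup>2 * r) (C4 * (w / real s))
           = max (real s powr (1 / q) * (C3 / \<kappa>\<^sup>2 * r)) (real s powr (1 / q) * (C4 * (w / real s)))"
          by (simp add: max_mult_distrib_left)
        also have "real s powr (1 / q) * (C4 * (w / real s)) = C4 * real s powr (1 / q - 1) * w"
          using s0 by (simp add: powr_diff)
        finally show ?thesis by (simp add: mult.commute mult.left_commute)
      qed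
      have "y \<in> space ?M" using y by (simp add: A_def regression_law_eq)
      then show "y \<in> ?E"
        using c1 c2 c3 unfolding P_def u_def h_def g_def r_def w_def L_def ell_def by blast
    qed
    then show ?thesis using A_sets A_prob unfolding prob_at_least_def by blast
  qed
  show ?thesis
    by (rule exI[of _ C1], rule exI[of _ C2], rule exI[of _ C3], rule exI[of _ C4])
       (intro conjI pos allI impI, rule main)
qed

end
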